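(* Let $f,g\in\mathcal{S}$. Suppose that $\frac{f(z)+g(z)}{z}\neq 0$ for $z\in\mathbb{D}$ (with the value at $z=0$ understood as the limit $2$), and consider the function $F$ defined by $$F(z)=\frac{2f(z)g(z)}{f(z)+g(z)}$$ (with $F(0)=0$). Then: (i) for $\lambda\in(0,1]$, the function $G$ defined by $G(z)=r^{-1}F(rz)$ belongs to $\mathcal{U}(\lambda)$ for $0<r\le\sqrt{\lambda/(1+\lambda)}$; (ii) in particular, $F$ belongs to $\mathcal{U}$ in the disk $|z|<1/\sqrt2\approx 0.707107$ (and hence $F$ is univalent in $\{z:|z|<1/\sqrt2\}$); (iii) in addition, $r^{-1}F(rz)$ belongs to $\mathcal{S}^*$ for $$0<r\le r_0=\sqrt{1-\frac{2}{4-|b_1+c_1|}},$$ where $b_1+c_1=-\frac{f''(0)+g''(0)}{2}=-F''(0)$.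
   Context: $\mathbb{D}=\{z\in\mathbb{C}:|z|<1\}$. $\mathcal{A}$ is the class of functions $f$ analytic in $\mathbb{D}$ with $f(0)=0$, $f'(0)=1$. $\mathcal{S}$ is the set of $f\in\mathcal{A}$ that are univalent (injective) in $\mathbb{D}$. $\mathcal{S}^*$ is the set of starlike functions, i.e. $f\in\mathcal{S}$ with $\mathrm{Re}\,(zf'(z)/f(z))>0$ for all $z\in\mathbb{D}$ (removable singularity at $0$ filled in). For $\lambda\in(0,1]$, $\mathcal{U}(\lambda)$ is the set of $f\in\mathcal{A}$ satisfying $$\left|f'(z)\left(\frac{z}{f(z)}\right)^2-1\right|<\lambda\quad\text{for all } z\in\mathbb{D},$$ where $z/f(z)$ is taken to be $1$ at $z=0$; and $\mathcal{U}:=\mathcal{U}(1)$. Saying that $F$ belongs to $\mathcal{U}$ in the disk $|z|<r$ means that this inequality with $\lambda=1$ holds for $F$ for all $|z|<r$, equivalently that $z\mapsto r^{-1}F(rz)$ belongs to $\mathcal{U}$. The numbers $b_1,c_1$ are the coefficients of $z$ in the expansions $z/f(z)=1+b_1z+b_2z^2+\cdots$ and $z/g(z)=1+c_1z+c_2z^2+\cdots$. *)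

theory Defs
  imports "HOL-Complex_Analysis.Complex_Analysis"
begin

definition class_A :: "(complex \<Rightarrow> complex) set" where
  "class_A = {f. f holomorphic_on ball 0 1 \<and> f 0 = 0 \<and> deriv f 0 = 1}"

definition class_S :: "(complex \<Rightarrow> complex) set" where
  "class_S = {f \<in> class_A. inj_on f (ball 0 1)}"

definition class_S_star :: "(complex \<Rightarrow> complex) set" where
  "class_S_star = {f \<in> class_S.
     \<forall>z\<in>ball 0 1. Re (if z = 0 then 1 else z * deriv f z / f z) > 0}"

text \<open>The function \<open>z / f(z)\<close>, with its removable singularity at \<open>0\<close> filled in.\<close>

definition z_over :: "(complex \<Rightarrow> complex) \<Rightarrow> complex \<Rightarrow> complex" where
  "z_over f z = (if z = 0 then 1 else z / f z)"

text \<open>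
  Zeros of \<open>f\<close> other than the origin are ruled out by the inequality itself: there, division
  by zero makes the left-hand side equal to \<open>1\<close>, which is not less than \<open>lam \<le> 1\<close>.
\<close>

definition class_U :: "real \<Rightarrow> (complex \<Rightarrow> complex) set" where
  "class_U lam = {f \<in> class_A.
     \<forall>z\<in>ball 0 1. norm (deriv f z * (z_over f z)\<^sup>2 - 1) < lam}"

text \<open>
  Membership in \<open>\<U> = \<U>(1)\<close> in the disk \<open>|z| < r\<close>, including analyticity and
  normalization; lemma \<open>U_in_disk_iff\<close> gives the equivalent description by rescaling.
\<close>

definition U_in_disk :: "(complex \<Rightarrow> complex) \<Rightarrow> real \<Rightarrow> bool" where
  "U_in_disk f r \<longleftrightarrow> f holomorphic_on ball 0 r \<and> f 0 = 0 \<and> deriv f 0 = 1 \<and>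
     (\<forall>z\<in>ball 0 r. norm (deriv f z * (z_over f z)\<^sup>2 - 1) < 1)"

definition rescale :: "real \<Rightarrow> (complex \<Rightarrow> complex) \<Rightarrow> complex \<Rightarrow> complex" where
  "rescale r f z = f (of_real r * z) / of_real r"

definition harmonic_mean :: "(complex \<Rightarrow> complex) \<Rightarrow> (complex \<Rightarrow> complex) \<Rightarrow> complex \<Rightarrow> complex" where
  "harmonic_mean f g z = (if z = 0 then 0 else 2 * f z * g z / (f z + g z))"

text \<open>The coefficient of \<open>z\<close> in the power series expansion of \<open>z / f(z)\<close> at the origin.\<close>

definition recip_coeff1 :: "(complex \<Rightarrow> complex) \<Rightarrow> complex" where
  "recip_coeff1 f = fps_nth (fps_expansion (z_over f) 0) 1"

lemma rescale_image_ball: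
  assumes "r > 0"
  shows "(\<lambda>z::complex. of_real r * z) ` ball 0 1 = ball 0 r"
proof (intro equalityI subsetI)
  fix w :: complex assume "w \<in> ball 0 r"
  then have "w / of_real r \<in> ball 0 1" and "w = of_real r * (w / of_real r)"
    using assms by (auto simp: norm_divide)
  then show "w \<in> (\<lambda>z. of_real r * z) ` ball 0 1" by blast
qed (use assms in \<open>auto simp: norm_mult\<close>)

lemma holomorphic_on_rescale_iff:
  assumes "r > 0"
  shows "rescale r f holomorphic_on ball 0 1 \<longleftrightarrow> f holomorphic_on ball 0 r"
proof
  assume "f holomorphic_on ball 0 r"
  then have "(f \<circ> (\<lambda>z. of_real r * z)) holomorphic_on ball 0 1"
    by (intro holomorphic_on_compose) (auto simp: rescale_image_ball[OF assms] intro!: holomorphic_intros)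
  then show "rescale r f holomorphic_on ball 0 1"
    unfolding rescale_def o_def using assms by (intro holomorphic_intros) auto
next
  assume h: "rescale r f holomorphic_on ball 0 1"
  have "(\<lambda>z::complex. z / of_real r) ` ball 0 r \<subseteq> ball 0 1"
    using assms by (auto simp: norm_divide)
  then have "(rescale r f \<circ> (\<lambda>z. z / of_real r)) holomorphic_on ball 0 r"
    using assms by (intro holomorphic_on_compose holomorphic_on_subset[OF h]) (auto intro!: holomorphic_intros)
  then have "(\<lambda>z. of_real r * (rescale r f \<circ> (\<lambda>z. z / of_real r)) z) holomorphic_on ball 0 r"
    by (intro holomorphic_intros)
  then show "f holomorphic_on ball 0 r"
    using assms by (simp add: rescale_def o_def)
qed

lemma deriv_rescale:
  assumes "r > 0" "f holomorphic_on ball 0 r" "z \<in> ball 0 1"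
  shows "deriv (rescale r f) z = deriv f (of_real r * z)"
proof -
  have "of_real r * z \<in> ball 0 r"
    using assms by (auto simp: norm_mult)
  then have "(f has_field_derivative deriv f (of_real r * z)) (at (of_real r * z))"
    using assms(2) holomorphic_derivI open_ball by blast
  then have "((\<lambda>z. f (of_real r * z)) has_field_derivative deriv f (of_real r * z) * of_real r) (at z)"
    by (rule DERIV_chain2) (auto intro!: derivative_eq_intros)
  then have "((\<lambda>z. f (of_real r * z) / of_real r) has_field_derivative
      deriv f (of_real r * z) * of_real r / of_real r) (at z)"
    by (rule DERIV_cdivide)
  then show ?thesis
    using assms(1) by (simp add: rescale_def[abs_def] DERIV_imp_deriv)
qed

lemma z_over_rescale:
  assumes "r > 0"
  shows "z_over (rescale r f) z = z_over f (of_real r * z)"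
  using assms by (simp add: z_over_def rescale_def field_simps)

lemma U_in_disk_iff:
  assumes "r > 0"
  shows "U_in_disk f r \<longleftrightarrow> rescale r f \<in> class_U 1"
proof (cases "f holomorphic_on ball 0 r")
  case True
  have "(\<forall>z\<in>ball 0 r. norm (deriv f z * (z_over f z)\<^sup>2 - 1) < 1) \<longleftrightarrow>
        (\<forall>z\<in>ball 0 1. norm (deriv (rescale r f) z * (z_over (rescale r f) z)\<^sup>2 - 1) < 1)"
    by (simp add: deriv_rescale[OF assms True] z_over_rescale[OF assms]
        flip: rescale_image_ball[OF assms])
  moreover have "deriv (rescale r f) 0 = deriv f 0"
    using deriv_rescale[OF assms True, of 0] by simp
  moreover have "rescale r f 0 = 0 \<longleftrightarrow> f 0 = 0"
    using assms by (simp add: rescale_def)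
  ultimately show ?thesis
    using True assms by (simp add: U_in_disk_def class_U_def class_A_def holomorphic_on_rescale_iff)
next
  case False
  then show ?thesis
    using assms by (simp add: U_in_disk_def class_U_def class_A_def holomorphic_on_rescale_iff)
qed

end

theory Submission
  imports Defs
begin

text \<open>
  Write \<open>z / f(z) = 1 + b\<^sub>1 z + b\<^sub>2 z\<^sup>2 + \<dots>\<close> for \<open>f\<close> in \<open>\<S>\<close>. The only consequences of
  univalence that the argument needs are Gronwall's area inequality
  \<open>\<Sum> (n - 1) |b\<^sub>n|\<^sup>2 \<le> 1\<close> (\<open>area_theorem\<close>) and Bieberbach's \<open>|b\<^sub>1| \<le> 2\<close>, which follows from it
  by a square root transform. The harmonic mean \<open>F\<close> of \<open>f\<close> and \<open>g\<close> satisfies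
  \<open>z / F = (z / f + z / g) / 2\<close>; since the area inequality is convex in the coefficients,
  \<open>P = z / F = 1 + B\<^sub>1 z + B\<^sub>2 z\<^sup>2 + \<dots>\<close> satisfies it as well, although \<open>1 / F\<close> may fail to be
  univalent. The hypothesis on \<open>f + g\<close> says that \<open>P\<close> has no zeros, so that \<open>F\<close> is holomorphic.

  By Cauchy-Schwarz, the area inequality gives
  \<open>\<Sum> (n - 1) |B\<^sub>n| \<rho>\<^sup>n \<le> \<rho>\<^sup>2 / (1 - \<rho>\<^sup>2)\<close>, and all three claims about \<open>F\<close> are read off from this
  one estimate. First, \<open>F' (z / F)\<^sup>2 - 1 = P - z P' - 1 = - \<Sum> (n - 1) B\<^sub>n z\<^sup>n\<close>, which is smaller than
  \<open>\<lambda>\<close> as soon as \<open>|z|\<^sup>2 < \<lambda> / (1 + \<lambda>)\<close>. Second, \<open>1 / F(z) - 1 / z = \<psi>(z)\<close> with \<open>\<psi> = (P - 1) / z\<close>, and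
  \<open>|\<psi>'| \<le> 1 / (1 - |z|\<^sup>2) < 2\<close> for \<open>|z|\<^sup>2 < 1/2\<close>, whereas \<open>z \<mapsto> 1 / z\<close> expands distances there by
  more than \<open>2\<close>; hence \<open>F\<close> is injective. Third, \<open>z F' / F = (P - z P') / P\<close> has positive real part
  if \<open>|z P'| < |2 P - z P'|\<close>, and comparing coefficients this holds if
  \<open>|B\<^sub>1| \<rho> + \<Sum> (n - 1) |B\<^sub>n| \<rho>\<^sup>n < 1\<close>, where \<open>\<rho> = |z|\<close>. The radius \<open>r\<^sub>0\<close> is exactly the one at which
  \<open>\<rho>\<^sup>2 / (1 - \<rho>\<^sup>2)\<close> reaches \<open>1 - |B\<^sub>1|\<close>. Bieberbach's bound ensures \<open>|b\<^sub>1 + c\<^sub>1| \<le> 4\<close>, so that the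
  formula for \<open>r\<^sub>0\<close> does not change sign beyond its pole.

  The area theorem is proved without the Jordan curve theorem or Green's theorem. The function
  \<open>h(z) = 1 / f(z)\<close> maps an annulus \<open>\<epsilon> < |z| < \<rho>\<close> injectively, so the area of the image is the
  integral of \<open>|h'|\<^sup>2\<close>, and in logarithmic coordinates this integral is bounded below by Bessel's
  inequality on circles (\<open>circle_Bessel_inequality\<close>). For the upper bound the image has to be
  enclosed in a set of area \<open>\<pi> / \<epsilon>\<^sup>2 + o(1)\<close>. A disc is too crude, because
  \<open>h(z) - b\<^sub>1 = 1 / z + b\<^sub>2 z + O(\<epsilon>\<^sup>2)\<close> maps \<open>|z| = \<epsilon>\<close> approximately to an ellipse, which deviates
  from a circle of radius \<open>1 / \<epsilon>\<close> by order \<open>\<epsilon>\<close>, so that the area of an enclosing disc is too large by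
  a constant. The
  real-linear map \<open>w \<mapsto> w - \<beta> cnj w\<close> with \<open>\<beta> = b\<^sub>2 \<epsilon>\<^sup>2\<close> straightens the ellipse up to \<open>O(\<epsilon>\<^sup>2)\<close>, while
  its Jacobian \<open>1 - |\<beta>|\<^sup>2 = 1 - O(\<epsilon>\<^sup>4)\<close> is harmless. A maximum principle on the annulus shows that
  bounding the boundary values suffices to enclose the whole image.
\<close>

section \<open>Power series and means over circles\<close>
lemma deriv_power_series:
  fixes a :: "nat \<Rightarrow> complex"
  assumes sums: "\<And>z. z \<in> ball 0 1 \<Longrightarrow> (\<lambda>n. a n * z ^ n) sums p z" and z: "z \<in> ball 0 1"
  shows "(\<lambda>n. of_nat n * a n * z ^ n) sums (z * deriv p z)"
proof -
  have "p holomorphic_on ball 0 1"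
    by (rule power_series_holomorphic[where a = a]) (use sums in simp)
  then have "(p has_field_derivative deriv p z) (at z)"
    using holomorphic_derivI[OF _ open_ball z] by blast
  then have "(\<lambda>n. diffs a n * z ^ n) sums deriv p z"
    by (intro termdiffs_sums_strong[where K = 1 and f = p]) (use sums z in auto)
  from sums_mult[OF this, of z]
  have "(\<lambda>n. of_nat (Suc n) * a (Suc n) * z ^ Suc n) sums (z * deriv p z)"
    by (simp add: diffs_def mult_ac)
  then show ?thesis
    by (subst (asm) sums_Suc_iff) simp
qed

text \<open>
  This is Cauchy's integral formula at the centre, written as an integral over the angle.
\<close>
lemma circle_mean_value:
  assumes hol: "f holomorphic_on ball 0 R" and r: "0 < r" "r < R"
  shows "((\<lambda>y. f (of_real r * cis y)) has_integral 2 * of_real pi * f 0) {0..2 * pi}"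
proof -
  have "f holomorphic_on cball 0 r"
    by (rule holomorphic_on_subset[OF hol]) (use r in auto)
  then have "((\<lambda>u. f u / (u - 0)) has_contour_integral (2 * of_real pi * \<i> * f 0)) (circlepath 0 r)"
    by (rule Cauchy_integral_circlepath_simple) (use r in auto)
  then have "((\<lambda>y. f (of_real r * cis y) / (of_real r * cis y) * of_real r * \<i> * cis y)
      has_integral (2 * of_real pi * \<i> * f 0)) {0..2 * pi}"
    unfolding circlepath_def by (subst (asm) has_contour_integral_part_circlepath_iff) auto
  then have "((\<lambda>y. \<i> * f (of_real r * cis y)) has_integral (\<i> * (2 * of_real pi * f 0))) {0..2 * pi}"
    using r by (simp add: field_simps)
  from has_integral_mult_right[OF this, of "-\<i>"] show ?thesis
    by (simp flip: mult.assoc)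
qed

text \<open>
  Induction on the number of coefficients: with \<open>q(z) = c\<^sub>0 + z q\<^sub>1(z)\<close>, the mean value property
  makes \<open>c\<^sub>0\<close> orthogonal to \<open>z q\<^sub>1(z)\<close> on the circle, and the induction hypothesis applies to \<open>q\<^sub>1\<close>.
\<close>
lemma circle_Bessel_inequality:
  assumes sums: "\<And>z. z \<in> ball 0 R \<Longrightarrow> (\<lambda>n. c n * z ^ n) sums q z" and r: "0 < r" "r < R"
  shows "2 * pi * (\<Sum>n<N. (norm (c n))\<^sup>2 * r ^ (2 * n))
         \<le> integral {0..2 * pi} (\<lambda>y. (norm (q (of_real r * cis y)))\<^sup>2)"
  using sums
proof (induction N arbitrary: c q)
  case 0
  let ?F = "\<lambda>y. (norm (q (of_real r * cis y)))\<^sup>2"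
  have "0 \<le> integral {0..2*pi} ?F"
    by (cases "?F integrable_on {0..2*pi}") (auto intro: integral_nonneg simp: not_integrable_integral)
  then show ?case by simp
next
  case (Suc N)
  define q1 where "q1 z = (\<Sum>n. c (Suc n) * z ^ n)" for z
  have q1: "(\<lambda>n. c (Suc n) * z ^ n) sums q1 z" if z: "z \<in> ball 0 R" for z
  proof -
    have "summable (\<lambda>n. c n * z ^ n)"
      using Suc.prems[OF z] by (rule sums_summable)
    then have "summable (\<lambda>n. c (Suc n) * z ^ n)"
      by (rule summable_powser_ignore_initial_segment[of c 1, simplified, THEN iffD2])
    then show ?thesis unfolding q1_def by (rule summable_sums)
  qed
  have q: "q z = c 0 + z * q1 z" if z: "z \<in> ball 0 R" for z
  proof -
    have "(\<lambda>n. z * (c (Suc n) * z ^ n)) sums (z * q1 z)"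
      by (rule sums_mult[OF q1[OF z]])
    then have "(\<lambda>n. c (Suc n) * z ^ Suc n) sums (z * q1 z)"
      by (simp add: mult_ac)
    then have "(\<lambda>n. c n * z ^ n) sums (z * q1 z + c 0)"
      by (subst (asm) sums_Suc_iff) simp
    with Suc.prems[OF z] show ?thesis
      using sums_unique2 by (metis add.commute)
  qed
  have hol: "q1 holomorphic_on ball 0 R"
    by (rule power_series_holomorphic[where a = "\<lambda>n. c (Suc n)"]) (use q1 in simp)
  have in_ball: "of_real r * cis y \<in> ball 0 R" for y
    using r by (simp add: norm_mult)
  have cont: "continuous_on {0..2*pi} (\<lambda>y. q1 (of_real r * cis y))"
    by (rule continuous_on_compose2[OF holomorphic_on_imp_continuous_on[OF hol]])
       (use in_ball in \<open>auto intro!: continuous_intros\<close>)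
  define X where "X y = Re (cnj (c 0) * (of_real r * cis y * q1 (of_real r * cis y)))" for y
  define Y where "Y y = (norm (q1 (of_real r * cis y)))\<^sup>2" for y
  have "(\<lambda>z. cnj (c 0) * (z * q1 z)) holomorphic_on ball 0 R"
    by (intro holomorphic_intros hol)
  from circle_mean_value[OF this r]
  have mean: "((\<lambda>y. cnj (c 0) * (of_real r * cis y * q1 (of_real r * cis y))) has_integral 0) {0..2*pi}"
    by (simp only: mult_zero_left mult_zero_right)
  have X: "(X has_integral 0) {0..2*pi}"
    unfolding X_def using has_integral_Re[OF mean] by (simp only: zero_complex.sel)
  have Y: "(Y has_integral integral {0..2*pi} Y) {0..2*pi}"
    unfolding Y_def by (intro integrable_integral integrable_continuous_interval continuous_intros cont)
  have split: "(norm (q (of_real r * cis y)))\<^sup>2 = (norm (c 0))\<^sup>2 + 2 * X y + r\<^sup>2 * Y y" for y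
  proof -
    define u where "u = of_real r * cis y * q1 (of_real r * cis y)"
    have "(norm (c 0 + u))\<^sup>2 = (norm (c 0))\<^sup>2 + 2 * Re (cnj (c 0) * u) + (norm u)\<^sup>2"
      unfolding cmod_power2 by (simp add: power2_eq_square algebra_simps)
    moreover have "(norm u)\<^sup>2 = r\<^sup>2 * Y y"
      by (simp add: u_def Y_def norm_mult power_mult_distrib)
    ultimately show ?thesis
      unfolding X_def q[OF in_ball] u_def by simp
  qed
  have "((\<lambda>y. (norm (c 0))\<^sup>2 + 2 * X y + r\<^sup>2 * Y y) has_integral
        2 * pi * (norm (c 0))\<^sup>2 + 2 * 0 + r\<^sup>2 * integral {0..2*pi} Y) {0..2*pi}"
    by (intro has_integral_add has_integral_mult_right X Y)
       (use has_integral_const_real[of "(norm (c 0))\<^sup>2" 0 "2*pi"] in simp)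
  then have "integral {0..2*pi} (\<lambda>y. (norm (q (of_real r * cis y)))\<^sup>2) =
        2 * pi * (norm (c 0))\<^sup>2 + r\<^sup>2 * integral {0..2*pi} Y"
    unfolding split by (simp add: integral_unique)
  moreover have "2 * pi * (\<Sum>n<N. (norm (c (Suc n)))\<^sup>2 * r ^ (2 * n)) \<le> integral {0..2*pi} Y"
    unfolding Y_def by (rule Suc.IH) (rule q1)
  then have "r\<^sup>2 * (2 * pi * (\<Sum>n<N. (norm (c (Suc n)))\<^sup>2 * r ^ (2 * n))) \<le> r\<^sup>2 * integral {0..2*pi} Y"
    by (rule mult_left_mono) simp
  moreover have "r\<^sup>2 * (2 * pi * (\<Sum>n<N. (norm (c (Suc n)))\<^sup>2 * r ^ (2 * n)))
      = 2 * pi * (\<Sum>n<N. (norm (c (Suc n)))\<^sup>2 * r ^ (2 * Suc n))"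
    by (simp add: sum_distrib_left power2_eq_square mult_ac)
  ultimately show ?case
    unfolding sum.lessThan_Suc_shift by (simp add: ring_distribs)
qed

section \<open>The area of the image of a rectangle\<close>
text \<open>
  The change of variables formula for Lebesgue measure concerns maps of
  \<open>real ^ n\<close>; the following identifies the complex plane with \<open>real ^ 2\<close>.
\<close>
definition vec_of_complex :: "complex \<Rightarrow> real ^ 2" where
  "vec_of_complex z = vector [Re z, Im z]"

definition complex_of_vec :: "real ^ 2 \<Rightarrow> complex" where
  "complex_of_vec v = Complex (v $ 1) (v $ 2)"

lemma complex_of_vec_inverse [simp]: "vec_of_complex (complex_of_vec v) = v"
  by (simp add: vec_of_complex_def complex_of_vec_def vec_eq_iff forall_2)

lemma vec_of_complex_inverse [simp]: "complex_of_vec (vec_of_complex z) = z"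
  by (simp add: vec_of_complex_def complex_of_vec_def)

lemma norm_vec_of_complex [simp]: "norm (vec_of_complex z) = norm z"
  by (simp add: vec_of_complex_def norm_vec_def L2_set_def sum_2 cmod_def)

lemma bounded_linear_vec_of_complex: "bounded_linear vec_of_complex"
  by (rule bounded_linear_intro[where K = 1])
     (simp_all, simp_all add: vec_of_complex_def vec_eq_iff forall_2)

lemma norm_complex_of_vec [simp]: "norm (complex_of_vec v) = norm v"
  by (metis complex_of_vec_inverse norm_vec_of_complex)

lemma bounded_linear_complex_of_vec: "bounded_linear complex_of_vec"
  by (rule bounded_linear_intro[where K = 1])
     (simp_all, simp_all add: complex_of_vec_def complex_eq_iff)

text \<open>
  Fubini's theorem for continuous functions on rectangles holds in product spaces, so the integral is
  transported from \<open>real ^ 2\<close> to \<open>real \<times> real\<close> by the measure-preserving coordinate change.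
\<close>
lemma integral_cbox_vec2:
  fixes F :: "complex \<Rightarrow> real"
  assumes "continuous_on (cbox (Complex a c) (Complex b d)) F"
  shows "((\<lambda>v. F (complex_of_vec v)) has_integral
           integral {a..b} (\<lambda>x. integral {c..d} (\<lambda>y. F (Complex x y))))
         (cbox (vector [a, c]) (vector [b, d]))"
proof -
  define h :: "real \<times> real \<Rightarrow> real ^ 2" where "h p = vector [fst p, snd p]" for p
  define g :: "real ^ 2 \<Rightarrow> real \<times> real" where "g v = (v $ 1, v $ 2)" for v
  have hg: "h (g v) = v" for v by (simp add: h_def g_def vec_eq_iff forall_2)
  have gh: "g (h p) = p" for p by (simp add: h_def g_def)
  have gbox: "g ` cbox u v = cbox (u $ 1, u $ 2) (v $ 1, v $ 2)" for u v :: "real ^ 2"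
  proof (intro equalityI subsetI)
    fix p assume "p \<in> cbox (u $ 1, u $ 2) (v $ 1, v $ 2)"
    then have "h p \<in> cbox u v"
      by (cases p) (auto simp: h_def mem_box_cart forall_2)
    then show "p \<in> g ` cbox u v" using gh by (metis image_eqI)
  qed (auto simp: g_def mem_box_cart forall_2)
  have hbox: "h ` cbox p q = cbox (h p) (h q)" for p q
  proof -
    have "g ` cbox (h p) (h q) = cbox p q" by (simp add: gbox h_def)
    then have "h ` cbox p q = h ` g ` cbox (h p) (h q)" by simp
    also have "\<dots> = cbox (h p) (h q)" by (simp add: image_image hg)
    finally show ?thesis .
  qed
  have contF: "continuous_on (cbox (a, c) (b, d)) (\<lambda>p. F (Complex (fst p) (snd p)))"
  proof (rule continuous_on_compose2[OF assms])
    show "continuous_on (cbox (a, c) (b, d)) (\<lambda>p. Complex (fst p) (snd p))"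
      by (intro continuous_intros)
  qed (auto simp: in_cbox_complex_iff)
  have "((\<lambda>p. F (Complex (fst p) (snd p))) has_integral
       integral {a..b} (\<lambda>x. integral {c..d} (\<lambda>y. F (Complex x y)))) (cbox (a, c) (b, d))"
    using integral_prod_continuous[OF contF] integrable_continuous[OF contF]
    by (simp add: has_integral_iff)
  then have "((\<lambda>v. F (Complex (fst (g v)) (snd (g v)))) has_integral
       (1 / 1) *\<^sub>R integral {a..b} (\<lambda>x. integral {c..d} (\<lambda>y. F (Complex x y)))) (h ` cbox (a, c) (b, d))"
  proof (rule has_integral_twiddle[where h = h and g = g, OF _ hg gh, rotated -1])
    show "continuous (at v) g" for v
      unfolding g_def by (intro continuous_intros)
    show "\<exists>w z. g ` cbox u v = cbox w z" for u v using gbox by blast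
    show "\<exists>w z. h ` cbox u v = cbox w z" for u v using hbox by blast
    show "measure lborel (g ` cbox u v) = 1 * measure lborel (cbox u v)" for u v
    proof (cases "cbox u v = {}")
      case False
      then have "u $ 1 \<le> v $ 1" "u $ 2 \<le> v $ 2"
        using interval_ne_empty_cart(1)[of u v] by auto
      then show ?thesis
        using False unfolding gbox content_Pair content_cbox_cart[OF False] by (simp add: UNIV_2)
    qed simp
  qed simp
  then show ?thesis
    unfolding hbox by (simp add: h_def g_def complex_of_vec_def)
qed

text \<open>
  Multiplication by \<open>D\<close> scales areas by \<open>|D|\<^sup>2\<close>. The map \<open>w \<mapsto> w - \<beta> cnj w\<close> stretches one axis by
  \<open>1 + |\<beta>|\<close> and the orthogonal one by \<open>1 - |\<beta>|\<close>.
\<close>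
lemma det_holomorphic_skew:
  "det (matrix (\<lambda>u. vec_of_complex (D * complex_of_vec u - \<beta> * cnj (D * complex_of_vec u))))
     = (1 - (norm \<beta>)\<^sup>2) * (norm D)\<^sup>2"
  by (simp add: det_2 matrix_def vec_of_complex_def complex_of_vec_def axis_def cmod_power2)
     (simp add: power2_eq_square algebra_simps)

text \<open>
  The left-hand side is the area of the image of the open rectangle under \<open>z \<mapsto> k(z) - \<beta> cnj (k(z))\<close>,
  and this image lies in a disc of radius \<open>M\<close>. The post-composition is injective as \<open>|\<beta>| < 1\<close>.
  Injectivity is asked of \<open>k\<close> on the open rectangle only, since \<open>k\<close> will be periodic with period equal
  to the height of the rectangle.
\<close>
lemma area_of_skewed_image_le:
  assumes hol: "k holomorphic_on S" and S: "open S" "cbox (Complex a c) (Complex b d) \<subseteq> S"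
    and inj: "inj_on k (box (Complex a c) (Complex b d))"
    and \<beta>: "norm \<beta> < 1"
    and bound: "\<And>z. z \<in> box (Complex a c) (Complex b d) \<Longrightarrow> norm (k z - \<beta> * cnj (k z)) \<le> M"
    and M: "0 \<le> M"
  shows "(1 - (norm \<beta>)\<^sup>2) * integral {a..b} (\<lambda>x. integral {c..d} (\<lambda>y. (norm (deriv k (Complex x y)))\<^sup>2))
         \<le> pi * M\<^sup>2"
proof -
  define Q :: "(real ^ 2) set" where "Q = box (vector [a, c]) (vector [b, d])"
  define G where "G v = vec_of_complex (k (complex_of_vec v) - \<beta> * cnj (k (complex_of_vec v)))" for v
  define G' where "G' v = (\<lambda>u. vec_of_complex (deriv k (complex_of_vec v) * complex_of_vec u
        - \<beta> * cnj (deriv k (complex_of_vec v) * complex_of_vec u)))" for v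
  have Q: "complex_of_vec v \<in> box (Complex a c) (Complex b d)" if "v \<in> Q" for v
    using that by (auto simp: Q_def mem_box_cart forall_2 in_box_complex_iff complex_of_vec_def)
  have QS: "complex_of_vec v \<in> S" if "v \<in> Q" for v
    using Q[OF that] S(2) box_subset_cbox by blast
  have der: "(G has_derivative G' v) (at v within Q)" if "v \<in> Q" for v
  proof -
    have "(k has_derivative (*) (deriv k (complex_of_vec v))) (at (complex_of_vec v))"
      using holomorphic_derivI[OF hol S(1) QS[OF that]] by (simp add: has_field_derivative_def)
    moreover have "(complex_of_vec has_derivative complex_of_vec) (at v within Q)"
      by (rule bounded_linear_imp_has_derivative[OF bounded_linear_complex_of_vec])
    ultimately have "((\<lambda>v. k (complex_of_vec v)) has_derivative
        (\<lambda>u. deriv k (complex_of_vec v) * complex_of_vec u)) (at v within Q)"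
      by (rule has_derivative_compose[rotated])
    then have "((\<lambda>v. k (complex_of_vec v) - \<beta> * cnj (k (complex_of_vec v))) has_derivative
        (\<lambda>u. deriv k (complex_of_vec v) * complex_of_vec u
           - \<beta> * cnj (deriv k (complex_of_vec v) * complex_of_vec u))) (at v within Q)"
      by (intro has_derivative_diff has_derivative_mult_right
            bounded_linear.has_derivative[OF bounded_linear_cnj]) auto
    then show ?thesis
      unfolding G_def G'_def by (rule bounded_linear.has_derivative[OF bounded_linear_vec_of_complex])
  qed
  have inj_skew: "w = w'" if "w - \<beta> * cnj w = w' - \<beta> * cnj w'" for w w'
  proof (rule ccontr)
    assume "w \<noteq> w'"
    have "w - w' = \<beta> * cnj (w - w')" using that by (simp add: algebra_simps)
    then have "norm (w - w') = norm \<beta> * norm (w - w')"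
      by (metis complex_mod_cnj norm_mult)
    with \<open>w \<noteq> w'\<close> \<beta> show False by simp
  qed
  have injG: "inj_on G Q"
  proof (rule inj_onI)
    fix u v assume "u \<in> Q" "v \<in> Q" "G u = G v"
    then have "k (complex_of_vec u) = k (complex_of_vec v)"
      unfolding G_def by (metis inj_skew vec_of_complex_inverse)
    then have "complex_of_vec u = complex_of_vec v"
      using inj_onD[OF inj] Q \<open>u \<in> Q\<close> \<open>v \<in> Q\<close> by blast
    then show "u = v" by (metis complex_of_vec_inverse)
  qed
  define I where "I = (1 - (norm \<beta>)\<^sup>2) * integral {a..b} (\<lambda>x. integral {c..d} (\<lambda>y. (norm (deriv k (Complex x y)))\<^sup>2))"
  have cont: "continuous_on (cbox (Complex a c) (Complex b d)) (\<lambda>z. (norm (deriv k z))\<^sup>2)"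
    using holomorphic_deriv[OF hol S(1)] S(2)
    by (intro continuous_intros) (meson continuous_on_subset holomorphic_on_imp_continuous_on)
  have "norm \<beta> * norm \<beta> \<le> 1 * 1" using \<beta> by (intro mult_mono) auto
  then have absdet: "\<bar>det (matrix (G' v))\<bar> = (1 - (norm \<beta>)\<^sup>2) * (norm (deriv k (complex_of_vec v)))\<^sup>2" for v
    unfolding G'_def det_holomorphic_skew by (simp add: power2_eq_square)
  have I: "((\<lambda>v. \<bar>det (matrix (G' v))\<bar>) has_integral I) Q"
    unfolding absdet I_def Q_def has_integral_open_interval
    by (intro has_integral_mult_right integral_cbox_vec2 cont)
  have Qm: "Q \<in> sets lebesgue" by (simp add: Q_def)
  have "measure lebesgue (G ` Q) = I"
    using measure_differentiable_image_eq[OF Qm der injG] I by (simp add: has_integral_iff)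
  moreover have "measure lebesgue (G ` Q) \<le> measure lebesgue (cball (0 :: real ^ 2) M)"
  proof (rule measure_mono_fmeasurable)
    show "G ` Q \<subseteq> cball 0 M"
      using bound Q by (auto simp: G_def)
    show "G ` Q \<in> sets lebesgue"
      using measurable_differentiable_image_eq[OF Qm der injG] I by (auto simp: has_integral_iff)
  qed auto
  moreover have "measure lebesgue (cball (0 :: real ^ 2) M) = pi * M\<^sup>2"
    using content_cball[OF M, of "0 :: real ^ 2"] by (simp add: unit_ball_vol_2)
  ultimately show ?thesis by (simp add: I_def)
qed

section \<open>The area theorem\<close>
text \<open>
  For each direction \<open>u\<close> the function \<open>Re (u (H - \<beta> cnj H))\<close> is the real part of the holomorphic
  function \<open>(u - cnj (u \<beta>)) H\<close>, to whose exponential the maximum modulus principle applies. Choosing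
  the direction of the value at \<open>z\<close> turns the bounds on real parts into a bound on the modulus.
\<close>
lemma skew_maximum_principle_annulus:
  assumes hol: "H holomorphic_on ball 0 1 - {0}" and \<epsilon>: "0 < \<epsilon>" "\<epsilon> < \<rho>" "\<rho> < 1"
    and bound: "\<And>z. norm z = \<epsilon> \<or> norm z = \<rho> \<Longrightarrow> norm (H z - \<beta> * cnj (H z)) \<le> M"
    and z: "\<epsilon> \<le> norm z" "norm z \<le> \<rho>"
  shows "norm (H z - \<beta> * cnj (H z)) \<le> M"
proof -
  define A where "A = cball 0 \<rho> - ball (0 :: complex) \<epsilon>"
  have A: "A \<subseteq> ball 0 1 - {0}" using \<epsilon> by (auto simp: A_def)
  have "closed A" unfolding A_def by (intro closed_Diff) auto
  have "ball 0 \<rho> - cball 0 \<epsilon> \<subseteq> interior A"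
    by (rule interior_maximal) (auto simp: A_def)
  then have frontier: "norm w = \<epsilon> \<or> norm w = \<rho>" if "w \<in> frontier A" for w
    using that \<open>closed A\<close> by (force simp: frontier_def A_def)
  define w where "w = H z - \<beta> * cnj (H z)"
  show ?thesis
  proof (cases "w = 0")
    case True
    have "0 \<le> norm (H (of_real \<epsilon>) - \<beta> * cnj (H (of_real \<epsilon>)))" by simp
    also have "\<dots> \<le> M" by (rule bound) (use \<epsilon> in simp)
    finally show ?thesis using True by (simp add: w_def)
  next
    case False
    define u where "u = cnj w / of_real (norm w)"
    have u: "norm u = 1" using False by (simp add: u_def norm_divide)
    define E where "E = (\<lambda>z. exp ((u - cnj (u * \<beta>)) * H z))"
    have Re_eq: "Re ((u - cnj (u * \<beta>)) * H z) = Re (u * (H z - \<beta> * cnj (H z)))" for z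
      by (simp add: algebra_simps)
    have holE: "E holomorphic_on ball 0 1 - {0}"
      unfolding E_def by (intro holomorphic_intros hol)
    have "norm (E z) \<le> exp M"
    proof (rule maximum_modulus_frontier[where f = E and S = A and \<xi> = z])
      show "E holomorphic_on interior A"
        by (rule holomorphic_on_subset[OF holE]) (use A interior_subset in blast)
      show "continuous_on (closure A) E"
        using \<open>closed A\<close> holomorphic_on_imp_continuous_on[OF holE] A
        by (simp add: continuous_on_subset)
      show "bounded A" by (rule bounded_subset[OF bounded_cball[of 0 \<rho>]]) (auto simp: A_def)
      show "z \<in> A" using z by (simp add: A_def)
      fix v assume "v \<in> frontier A"
      have "Re (u * (H v - \<beta> * cnj (H v))) \<le> norm (u * (H v - \<beta> * cnj (H v)))"
        by (rule complex_Re_le_cmod)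
      also have "\<dots> \<le> M"
        using bound[OF frontier[OF \<open>v \<in> frontier A\<close>]] u by (simp add: norm_mult)
      finally show "norm (E v) \<le> exp M" unfolding E_def norm_exp_eq_Re Re_eq by simp
    qed
    then have "Re (u * w) \<le> M" unfolding E_def norm_exp_eq_Re Re_eq w_def by simp
    moreover have "u * w = of_real (norm w)"
      using False by (simp add: u_def power2_eq_square field_simps flip: complex_norm_square)
    ultimately have "norm w \<le> M" by (metis Re_complex_of_real)
    then show ?thesis by (simp only: w_def)
  qed
qed

text \<open>
  Here \<open>H(z) = p(z) / z - a\<^sub>1\<close> with \<open>p(z) = \<Sum> a\<^sub>n z\<^sup>n\<close>. In the coordinate \<open>\<zeta> = ln z\<close> the annulus becomes
  a rectangle of height \<open>2 \<pi>\<close>, and \<open>k(\<zeta>) = H(exp \<zeta>)\<close> has derivative \<open>q(z) / z\<close> with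
  \<open>q(z) = z p'(z) - p(z) = \<Sum> (n - 1) a\<^sub>n z\<^sup>n\<close>. Bessel's inequality for \<open>q\<close> on each vertical segment,
  integrated over the segments, bounds the area of the image from below by the sum on the left.
\<close>
lemma annulus_area_bound:
  assumes sums: "\<And>z. z \<in> ball 0 1 \<Longrightarrow> (\<lambda>n. a n * z ^ n) sums p z" and a0: "a 0 = 1"
    and inj: "inj_on (\<lambda>z. p z / z) (ball 0 1 - {0})"
    and \<epsilon>: "0 < \<epsilon>" "\<epsilon> < \<rho>" "\<rho> < 1" and \<beta>: "norm \<beta> < 1"
    and H: "\<And>z. H z = p z / z - a 1"
    and bound: "\<And>z. norm z = \<epsilon> \<or> norm z = \<rho> \<Longrightarrow> norm (H z - \<beta> * cnj (H z)) \<le> M"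
  shows "(1 - (norm \<beta>)\<^sup>2) * (1 / \<epsilon>\<^sup>2 - 1 / \<rho>\<^sup>2
           + (\<Sum>n<N. real (n + 1) * (norm (a (n + 2)))\<^sup>2 * (\<rho> ^ (2 * n + 2) - \<epsilon> ^ (2 * n + 2)))) \<le> M\<^sup>2"
proof -
  have holp: "p holomorphic_on ball 0 1"
    by (rule power_series_holomorphic[where a = a]) (use sums in simp)
  have holH: "H holomorphic_on ball 0 1 - {0}"
    unfolding H[abs_def] by (intro holomorphic_intros holomorphic_on_subset[OF holp]) auto
  define S where "S = {\<zeta>. Re \<zeta> < 0}"
  have S: "open S" unfolding S_def by (rule open_halfspace_Re_lt)
  have expS: "exp \<zeta> \<in> ball 0 1 - {0}" if "\<zeta> \<in> S" for \<zeta>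
    using that by (simp add: S_def norm_exp_eq_Re)
  define k where "k = H \<circ> exp"
  have holk: "k holomorphic_on S"
    unfolding k_def by (rule holomorphic_on_compose_gen[OF _ holH]) (use expS in \<open>auto intro: holomorphic_intros\<close>)
  define q where "q z = z * deriv p z - p z" for z
  have q_sums: "(\<lambda>n. (of_nat n - 1) * a n * z ^ n) sums q z" if z: "z \<in> ball 0 1" for z
  proof -
    from sums_diff[OF deriv_power_series[OF sums z] sums[OF z]] show ?thesis
      by (simp add: q_def algebra_simps)
  qed
  have deriv_k: "deriv k \<zeta> = q (exp \<zeta>) / exp \<zeta>" if "\<zeta> \<in> S" for \<zeta>
  proof (rule DERIV_imp_deriv)
    have p': "(p has_field_derivative deriv p (exp \<zeta>)) (at (exp \<zeta>))"
      using holomorphic_derivI[OF holp] expS[OF that] by auto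
    have "((\<lambda>\<zeta>. p (exp \<zeta>) / exp \<zeta> - a 1) has_field_derivative
       ((deriv p (exp \<zeta>) * exp \<zeta>) * exp \<zeta> - p (exp \<zeta>) * exp \<zeta>) / (exp \<zeta> * exp \<zeta>) - 0) (at \<zeta>)"
      by (intro DERIV_diff DERIV_divide DERIV_chain2[where f = p and g = exp, OF p'] DERIV_exp DERIV_const) auto
    moreover have "((deriv p (exp \<zeta>) * exp \<zeta>) * exp \<zeta> - p (exp \<zeta>) * exp \<zeta>) / (exp \<zeta> * exp \<zeta>) - 0
        = q (exp \<zeta>) / exp \<zeta>"
      by (simp add: q_def field_simps)
    ultimately show "(k has_field_derivative q (exp \<zeta>) / exp \<zeta>) (at \<zeta>)"
      by (simp only: k_def o_def H)
  qed
  have box: "cbox (Complex (ln \<epsilon>) 0) (Complex (ln \<rho>) (2 * pi)) \<subseteq> S"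
  proof
    fix \<zeta> assume "\<zeta> \<in> cbox (Complex (ln \<epsilon>) 0) (Complex (ln \<rho>) (2 * pi))"
    then have "Re \<zeta> \<le> ln \<rho>" by (simp add: in_cbox_complex_iff)
    also have "ln \<rho> < 0" using \<epsilon> by simp
    finally show "\<zeta> \<in> S" by (simp add: S_def)
  qed
  have injk: "inj_on k (box (Complex (ln \<epsilon>) 0) (Complex (ln \<rho>) (2 * pi)))"
  proof (rule inj_onI)
    fix \<zeta> \<omega> assume *: "\<zeta> \<in> box (Complex (ln \<epsilon>) 0) (Complex (ln \<rho>) (2 * pi))"
      "\<omega> \<in> box (Complex (ln \<epsilon>) 0) (Complex (ln \<rho>) (2 * pi))" "k \<zeta> = k \<omega>"
    then have "\<zeta> \<in> S" "\<omega> \<in> S" using box box_subset_cbox by blast+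
    then have "exp \<zeta> = exp \<omega>"
      using inj_onD[OF inj, of "exp \<zeta>" "exp \<omega>"] * expS by (simp add: k_def H)
    then show "\<zeta> = \<omega>"
      by (rule exp_complex_eqI[rotated]) (use * in \<open>auto simp: in_box_complex_iff\<close>)
  qed
  have M: "0 \<le> M"
    using bound[of "of_real \<epsilon>"] \<epsilon> norm_ge_zero[of "H (of_real \<epsilon>) - \<beta> * cnj (H (of_real \<epsilon>))"]
    by (smt (verit) norm_of_real)
  have boundk: "norm (k \<zeta> - \<beta> * cnj (k \<zeta>)) \<le> M"
    if "\<zeta> \<in> box (Complex (ln \<epsilon>) 0) (Complex (ln \<rho>) (2 * pi))" for \<zeta>
  proof -
    have "ln \<epsilon> < Re \<zeta>" "Re \<zeta> < ln \<rho>" using that by (auto simp: in_box_complex_iff)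
    then have "\<epsilon> < norm (exp \<zeta>)" "norm (exp \<zeta>) < \<rho>"
      using exp_less_mono[of "ln \<epsilon>" "Re \<zeta>"] exp_less_mono[of "Re \<zeta>" "ln \<rho>"] \<epsilon>
      by (auto simp: norm_exp_eq_Re)
    then show ?thesis
      unfolding k_def o_def by (intro skew_maximum_principle_annulus[OF holH \<epsilon> bound]) auto
  qed
  define J where "J x = integral {0..2*pi} (\<lambda>y. (norm (deriv k (Complex x y)))\<^sup>2)" for x
  have area: "(1 - (norm \<beta>)\<^sup>2) * integral {ln \<epsilon>..ln \<rho>} J \<le> pi * M\<^sup>2"
    unfolding J_def by (rule area_of_skewed_image_le[OF holk S box injk \<beta> boundk M])
  have contJ: "continuous_on {ln \<epsilon>..ln \<rho>} J"
    unfolding J_def cbox_interval[symmetric]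
  proof (rule integral_continuous_on_param)
    have "continuous_on (cbox (ln \<epsilon>) (ln \<rho>) \<times> cbox 0 (2 * pi)) (\<lambda>v. deriv k (Complex (fst v) (snd v)))"
      by (rule continuous_on_compose2[OF holomorphic_on_imp_continuous_on[OF holomorphic_deriv[OF holk S]]])
         (use box in \<open>auto intro!: continuous_intros simp: subset_iff in_cbox_complex_iff\<close>)
    then show "continuous_on (cbox (ln \<epsilon>) (ln \<rho>) \<times> cbox 0 (2 * pi)) (\<lambda>(x, y). (norm (deriv k (Complex x y)))\<^sup>2)"
      by (auto simp: case_prod_beta intro!: continuous_intros)
  qed
  \<comment> \<open>The lower bound \<open>L\<close> for the integral over one segment and its antiderivative \<open>\<Phi>\<close>. The summand
    \<open>exp (- 2 x)\<close> is the contribution of the pole; the coefficient \<open>a\<^sub>1\<close> drops out.\<close>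
  define L where "L x = 2 * pi * (exp (- 2 * x)
      + (\<Sum>n<N. (real (n + 1))\<^sup>2 * (norm (a (n + 2)))\<^sup>2 * exp (x * real (2 * n + 2))))" for x
  define \<Phi> where "\<Phi> x = pi * (- exp (- 2 * x)
      + (\<Sum>n<N. real (n + 1) * (norm (a (n + 2)))\<^sup>2 * exp (x * real (2 * n + 2))))" for x
  have LJ: "L x \<le> J x" if x: "x \<in> {ln \<epsilon>..ln \<rho>}" for x
  proof -
    have "x \<le> ln \<rho>" using x by simp
    also have "ln \<rho> < 0" using \<epsilon> by simp
    finally have "x < 0" .
    then have ex: "0 < exp x" "exp x < 1" by simp_all
    have "(norm (deriv k (Complex x y)))\<^sup>2 = exp (- 2 * x) * (norm (q (of_real (exp x) * cis y)))\<^sup>2" for y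
    proof -
      have "exp (Complex x y) = of_real (exp x) * cis y"
        by (simp add: exp_eq_polar)
      moreover have "Complex x y \<in> S" using \<open>x < 0\<close> by (simp add: S_def)
      ultimately have "deriv k (Complex x y) = q (of_real (exp x) * cis y) / (of_real (exp x) * cis y)"
        by (simp add: deriv_k)
      then have "(norm (deriv k (Complex x y)))\<^sup>2 = (norm (q (of_real (exp x) * cis y)))\<^sup>2 / (exp x)\<^sup>2"
        by (simp add: norm_divide norm_mult power_divide)
      moreover have "exp (- 2 * x) = 1 / (exp x)\<^sup>2"
        by (simp add: exp_minus exp_double divide_inverse)
      ultimately show ?thesis by simp
    qed
    then have J: "J x = exp (- 2 * x) * integral {0..2*pi} (\<lambda>y. (norm (q (of_real (exp x) * cis y)))\<^sup>2)"
      by (simp add: J_def)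
    have "2 * pi * (\<Sum>n<N+2. (norm ((of_nat n - 1) * a n))\<^sup>2 * exp x ^ (2 * n))
        \<le> integral {0..2*pi} (\<lambda>y. (norm (q (of_real (exp x) * cis y)))\<^sup>2)"
      by (rule circle_Bessel_inequality[of 1, OF q_sums ex])
    then have "exp (- 2 * x) * (2 * pi * (\<Sum>n<N+2. (norm ((of_nat n - 1) * a n))\<^sup>2 * exp x ^ (2 * n))) \<le> J x"
      unfolding J by (rule mult_left_mono) simp
    also have "(\<Sum>n<N+2. (norm ((of_nat n - 1) * a n))\<^sup>2 * exp x ^ (2 * n))
        = 1 + (\<Sum>n<N. (norm (of_nat (n + 1) * a (n + 2)))\<^sup>2 * exp x ^ (2 * (n + 2)))"
      by (simp add: sum.lessThan_Suc_shift a0 algebra_simps del: sum.lessThan_Suc)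
    also have "exp (- 2 * x) * (2 * pi * \<dots>) = 2 * pi * (exp (- 2 * x)
         + (\<Sum>n<N. exp (- 2 * x) * ((norm (of_nat (n + 1) * a (n + 2)))\<^sup>2 * exp x ^ (2 * (n + 2)))))"
      by (simp add: sum_distrib_left algebra_simps)
    also have "\<dots> = L x"
    proof -
      have "exp (- 2 * x) * ((norm (of_nat (n + 1) * a (n + 2)))\<^sup>2 * exp x ^ (2 * (n + 2)))
          = (real (n + 1))\<^sup>2 * (norm (a (n + 2)))\<^sup>2 * exp (x * real (2 * n + 2))" for n
      proof -
        have e1: "exp (- 2 * x) * exp x ^ (2 * (n + 2)) = exp (x * real (2 * n + 2))"
          by (simp add: algebra_simps flip: exp_of_nat_mult exp_add)
        have e2: "norm (of_nat (n + 1) * a (n + 2)) = real (n + 1) * norm (a (n + 2))"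
          by (metis norm_mult norm_of_nat)
        show ?thesis unfolding e2 e1[symmetric] by (simp only: power_mult_distrib mult_ac)
      qed
      then show ?thesis by (simp add: L_def)
    qed
    finally show ?thesis .
  qed
  have d\<Phi>: "(\<Phi> has_real_derivative L x) (at x within X)" for x X
    unfolding \<Phi>_def L_def
    by (auto intro!: derivative_eq_intros sum.cong simp: sum_distrib_left algebra_simps power2_eq_square)
  have "ln \<epsilon> \<le> ln \<rho>" using \<epsilon> by simp
  then have "(L has_integral (\<Phi> (ln \<rho>) - \<Phi> (ln \<epsilon>))) {ln \<epsilon>..ln \<rho>}"
    by (rule fundamental_theorem_of_calculus) (use d\<Phi> in \<open>simp add: has_real_derivative_iff_has_vector_derivative\<close>)
  moreover have "(J has_integral integral {ln \<epsilon>..ln \<rho>} J) {ln \<epsilon>..ln \<rho>}"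
    by (intro integrable_integral integrable_continuous_interval contJ)
  ultimately have "\<Phi> (ln \<rho>) - \<Phi> (ln \<epsilon>) \<le> integral {ln \<epsilon>..ln \<rho>} J"
    using LJ by (rule has_integral_le)
  moreover have "norm \<beta> * norm \<beta> \<le> 1 * 1" using \<beta> by (intro mult_mono) auto
  ultimately have "(1 - (norm \<beta>)\<^sup>2) * (\<Phi> (ln \<rho>) - \<Phi> (ln \<epsilon>)) \<le> (1 - (norm \<beta>)\<^sup>2) * integral {ln \<epsilon>..ln \<rho>} J"
    by (intro mult_left_mono) (simp_all add: power2_eq_square)
  with area have "(1 - (norm \<beta>)\<^sup>2) * (\<Phi> (ln \<rho>) - \<Phi> (ln \<epsilon>)) \<le> pi * M\<^sup>2" by linarith
  moreover have "\<Phi> (ln t) = pi * (- 1 / t\<^sup>2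
      + (\<Sum>n<N. real (n + 1) * (norm (a (n + 2)))\<^sup>2 * t ^ (2 * n + 2)))" if "t > 0" for t
  proof -
    have "exp (ln t * real m) = t ^ m" for m
      using that by (metis exp_ln exp_of_nat2_mult)
    moreover have "exp (- 2 * ln t) = 1 / t\<^sup>2"
      using that by (simp add: exp_minus exp_double divide_inverse)
    ultimately show ?thesis by (simp only: \<Phi>_def) simp
  qed
  ultimately have "pi * ((1 - (norm \<beta>)\<^sup>2) * (1 / \<epsilon>\<^sup>2 - 1 / \<rho>\<^sup>2
     + (\<Sum>n<N. real (n + 1) * (norm (a (n + 2)))\<^sup>2 * (\<rho> ^ (2 * n + 2) - \<epsilon> ^ (2 * n + 2))))) \<le> pi * M\<^sup>2"
    using \<epsilon> by (simp add: right_diff_distrib sum_subtractf algebra_simps)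
  then show ?thesis by simp
qed

text \<open>
  On \<open>|z| = \<epsilon>\<close> one has \<open>\<epsilon>\<^sup>2 cnj (1 / z) = z\<close>, so subtracting \<open>a\<^sub>2 \<epsilon>\<^sup>2 cnj H\<close> from
  \<open>H(z) = 1 / z + a\<^sub>2 z + O(z\<^sup>2)\<close> cancels the linear term.
\<close>
lemma skewed_circle_image_bound:
  fixes a :: "nat \<Rightarrow> complex"
  assumes sums: "\<And>z. z \<in> ball 0 1 \<Longrightarrow> (\<lambda>n. a n * z ^ n) sums p z" and a0: "a 0 = 1"
    and H: "\<And>z. H z = p z / z - a 1"
  obtains K where "0 \<le> K" "\<And>\<epsilon> z. \<lbrakk>0 < \<epsilon>; \<epsilon> \<le> 1 / 2; norm z = \<epsilon>\<rbrakk> \<Longrightarrow>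
    norm (H z - a 2 * of_real \<epsilon> ^ 2 * cnj (H z)) \<le> 1 / \<epsilon> + K * \<epsilon>\<^sup>2"
proof -
  define s where "s z = (\<Sum>n. a (n + 3) * z ^ n)" for z
  have s: "(\<lambda>n. a (n + 3) * z ^ n) sums s z" if z: "z \<in> ball 0 1" for z
    unfolding s_def
    using sums_summable[OF sums[OF z]] summable_powser_ignore_initial_segment[of a 3 z]
    by (intro summable_sums) simp
  have p: "p z = 1 + a 1 * z + a 2 * z ^ 2 + z ^ 3 * s z" if z: "z \<in> ball 0 1" for z
  proof -
    have "(\<lambda>n. z ^ 3 * (a (n + 3) * z ^ n)) sums (z ^ 3 * s z)"
      by (rule sums_mult[OF s[OF z]])
    then have "(\<lambda>n. a (n + 3) * z ^ (n + 3)) sums (z ^ 3 * s z)"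
      by (simp add: power_add mult_ac)
    then have "(\<lambda>n. a n * z ^ n) sums (z ^ 3 * s z + (\<Sum>n<3. a n * z ^ n))"
      by (subst (asm) sums_iff_shift) simp
    with sums[OF z] have "p z = z ^ 3 * s z + (\<Sum>n<3. a n * z ^ n)"
      using sums_unique2 by blast
    then show ?thesis by (simp add: a0 numeral_3_eq_3 numeral_2_eq_2)
  qed
  have "s holomorphic_on ball 0 1"
    by (rule power_series_holomorphic[where a = "\<lambda>n. a (n + 3)"]) (use s in simp)
  then have "continuous_on (cball 0 (1/2)) s"
    by (intro holomorphic_on_imp_continuous_on) (auto elim: holomorphic_on_subset)
  then have "bounded (s ` cball 0 (1/2))"
    by (intro compact_imp_bounded compact_continuous_image) auto
  then obtain C where C: "\<And>z. z \<in> cball 0 (1/2) \<Longrightarrow> norm (s z) \<le> C"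
    unfolding bounded_iff by blast
  have "0 \<le> C" using order_trans[OF norm_ge_zero C[of 0]] by simp
  define K where "K = C + norm (a 2) * (norm (a 2) + C)"
  show thesis
  proof (rule that)
    show "0 \<le> K" using \<open>0 \<le> C\<close> by (simp add: K_def)
    fix \<epsilon> :: real and z :: complex
    assume \<epsilon>: "0 < \<epsilon>" "\<epsilon> \<le> 1 / 2" and z: "norm z = \<epsilon>"
    have z0: "z \<noteq> 0" "z \<in> ball 0 1" using \<epsilon> z by auto
    define t where "t = a 2 * z + z ^ 2 * s z"
    have Hz: "H z = 1 / z + t"
      using z0(1) unfolding H p[OF z0(2)] t_def by (simp add: field_simps power2_eq_square power3_eq_cube)
    have "z * cnj z = of_real \<epsilon> ^ 2" using z by (simp flip: complex_norm_square)
    then have skew: "of_real \<epsilon> ^ 2 * cnj (1 / z) = z" using z0 by (simp add: field_simps)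
    have "H z - a 2 * of_real \<epsilon> ^ 2 * cnj (H z)
        = 1 / z + t - a 2 * (of_real \<epsilon> ^ 2 * cnj (1 / z)) - a 2 * of_real \<epsilon> ^ 2 * cnj t"
      unfolding Hz by (simp add: algebra_simps)
    also have "\<dots> = 1 / z + (z ^ 2 * s z - a 2 * of_real \<epsilon> ^ 2 * cnj t)"
      unfolding skew by (simp add: t_def)
    also have "norm \<dots> \<le> norm (1 / z) + norm (z ^ 2 * s z - a 2 * of_real \<epsilon> ^ 2 * cnj t)"
      by (rule norm_triangle_ineq)
    also have "\<dots> \<le> norm (1 / z) + (norm (z ^ 2 * s z) + norm (a 2 * of_real \<epsilon> ^ 2 * cnj t))"
      by (intro add_left_mono norm_triangle_ineq4)
    also have "\<dots> = 1 / \<epsilon> + \<epsilon>\<^sup>2 * (norm (s z) + norm (a 2) * norm t)"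
      using z \<epsilon> by (simp add: norm_mult norm_divide norm_power algebra_simps)
    also have "\<dots> \<le> 1 / \<epsilon> + \<epsilon>\<^sup>2 * (C + norm (a 2) * (norm (a 2) + C))"
    proof -
      have sC: "norm (s z) \<le> C" using C z \<epsilon> by simp
      have "norm t \<le> norm (a 2) * \<epsilon> + \<epsilon>\<^sup>2 * norm (s z)"
        unfolding t_def using norm_triangle_ineq[of "a 2 * z" "z ^ 2 * s z"] z
        by (simp add: norm_mult norm_power)
      also have "\<dots> \<le> norm (a 2) * 1 + 1 * C"
        using \<epsilon> sC \<open>0 \<le> C\<close> by (intro add_mono mult_mono) (auto simp: power_le_one)
      finally show ?thesis
        using sC by (intro add_left_mono mult_left_mono add_mono) auto
    qed
    finally show "norm (H z - a 2 * of_real \<epsilon> ^ 2 * cnj (H z)) \<le> 1 / \<epsilon> + K * \<epsilon>\<^sup>2"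
      by (simp add: K_def mult.commute)
  qed
qed

text \<open>
  In \<open>annulus_area_bound\<close> with \<open>\<beta> = a\<^sub>2 \<epsilon>\<^sup>2\<close> and \<open>M = 1 / \<epsilon> + K \<epsilon>\<^sup>2\<close> the terms \<open>1 / \<epsilon>\<^sup>2\<close> on both sides
  cancel, and the remaining error terms vanish as \<open>\<epsilon>\<close> tends to \<open>0\<close>.
\<close>
lemma area_inequality_in_smaller_disc:
  fixes a :: "nat \<Rightarrow> complex"
  assumes sums: "\<And>z. z \<in> ball 0 1 \<Longrightarrow> (\<lambda>n. a n * z ^ n) sums p z" and a0: "a 0 = 1"
    and inj: "inj_on (\<lambda>z. p z / z) (ball 0 1 - {0})"
    and \<rho>: "0 < \<rho>" "\<rho> < 1"
  shows "(\<Sum>n<N. real (n + 1) * (norm (a (n + 2)))\<^sup>2 * \<rho> ^ (2 * n + 2)) \<le> 1 / \<rho>\<^sup>2"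
proof -
  define H where "H z = p z / z - a 1" for z
  obtain K where K: "0 \<le> K" "\<And>\<epsilon> z. \<lbrakk>0 < \<epsilon>; \<epsilon> \<le> 1 / 2; norm z = \<epsilon>\<rbrakk> \<Longrightarrow>
      norm (H z - a 2 * of_real \<epsilon> ^ 2 * cnj (H z)) \<le> 1 / \<epsilon> + K * \<epsilon>\<^sup>2"
    using skewed_circle_image_bound[where p = p and H = H, OF sums a0 H_def] by blast
  have "p holomorphic_on ball 0 1"
    by (rule power_series_holomorphic[where a = a]) (use sums in simp)
  then have "H holomorphic_on ball 0 1 - {0}"
    unfolding H_def[abs_def] by (intro holomorphic_intros) (auto elim: holomorphic_on_subset)
  then have "continuous_on (sphere 0 \<rho>) H"
    by (intro holomorphic_on_imp_continuous_on) (use \<rho> in \<open>auto elim!: holomorphic_on_subset\<close>)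
  then have "bounded (H ` sphere 0 \<rho>)"
    by (intro compact_imp_bounded compact_continuous_image) auto
  then obtain C where C: "\<And>z. norm z = \<rho> \<Longrightarrow> norm (H z) \<le> C"
    by (metis bounded_iff imageI mem_sphere_0)
  define s where "s \<epsilon> = (\<Sum>n<N. real (n + 1) * (norm (a (n + 2)))\<^sup>2 * (\<rho> ^ (2 * n + 2) - \<epsilon> ^ (2 * n + 2)))"
    for \<epsilon> :: real
  define \<beta> where "\<beta> \<epsilon> = norm (a 2) * \<epsilon>\<^sup>2" for \<epsilon> :: real
  have small: "eventually (\<lambda>\<epsilon>. 0 < \<epsilon> \<and> \<epsilon> < 1 / 2 \<and> \<epsilon> < \<rho> \<and> \<beta> \<epsilon> < 1 \<and> 2 * C * \<epsilon> < 1) (at_right 0)"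
  proof (intro eventually_conj)
    show "eventually (\<lambda>\<epsilon>::real. 0 < \<epsilon>) (at_right 0)"
      by (rule eventually_at_right_less)
    show "eventually (\<lambda>\<epsilon>::real. \<epsilon> < 1 / 2) (at_right 0)" "eventually (\<lambda>\<epsilon>. \<epsilon> < \<rho>) (at_right 0)"
      by (rule order_tendstoD(2)[OF tendsto_ident_at]; use \<rho> in simp)+
    have "((\<lambda>\<epsilon>. \<beta> \<epsilon>) \<longlongrightarrow> norm (a 2) * 0\<^sup>2) (at_right 0)"
      unfolding \<beta>_def by (intro tendsto_intros)
    then show "eventually (\<lambda>\<epsilon>. \<beta> \<epsilon> < 1) (at_right 0)" by (rule order_tendstoD) simp
    have "((\<lambda>\<epsilon>. 2 * C * \<epsilon>) \<longlongrightarrow> 2 * C * 0) (at_right 0)"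
      by (intro tendsto_intros)
    then show "eventually (\<lambda>\<epsilon>. 2 * C * \<epsilon> < 1) (at_right 0)" by (rule order_tendstoD) simp
  qed
  have "eventually (\<lambda>\<epsilon>. (1 - (\<beta> \<epsilon>)\<^sup>2) * (s \<epsilon> - 1 / \<rho>\<^sup>2)
          \<le> 2 * K * \<epsilon> + K\<^sup>2 * \<epsilon> ^ 4 + (norm (a 2))\<^sup>2 * \<epsilon>\<^sup>2) (at_right 0)"
    using small
  proof eventually_elim
    case (elim \<epsilon>)
    have norm_\<beta>: "norm (a 2 * of_real \<epsilon> ^ 2) = \<beta> \<epsilon>"
      by (simp add: \<beta>_def norm_mult norm_power)
    have "(1 - (norm (a 2 * of_real \<epsilon> ^ 2))\<^sup>2) * (1 / \<epsilon>\<^sup>2 - 1 / \<rho>\<^sup>2 + s \<epsilon>) \<le> (1 / \<epsilon> + K * \<epsilon>\<^sup>2)\<^sup>2"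
      unfolding s_def
    proof (rule annulus_area_bound[where p = p and H = H, OF sums a0 inj])
      fix z :: complex assume "norm z = \<epsilon> \<or> norm z = \<rho>"
      then show "norm (H z - a 2 * of_real \<epsilon> ^ 2 * cnj (H z)) \<le> 1 / \<epsilon> + K * \<epsilon>\<^sup>2"
      proof
        \<comment> \<open>The outer circle is fixed, so its image is small compared with \<open>1 / \<epsilon>\<close>.\<close>
        assume "norm z = \<rho>"
        have "norm (H z - a 2 * of_real \<epsilon> ^ 2 * cnj (H z)) \<le> norm (H z) + \<beta> \<epsilon> * norm (H z)"
          using norm_triangle_ineq4[of "H z" "a 2 * of_real \<epsilon> ^ 2 * cnj (H z)"]
          unfolding norm_mult norm_\<beta>[unfolded norm_mult] by simp
        also have "\<dots> \<le> norm (H z) + 1 * norm (H z)"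
          using elim by (intro add_left_mono mult_right_mono) auto
        also have "\<dots> \<le> 2 * C" using C[OF \<open>norm z = \<rho>\<close>] by simp
        also have "\<dots> \<le> 1 / \<epsilon>" using elim by (simp add: field_simps)
        also have "\<dots> \<le> 1 / \<epsilon> + K * \<epsilon>\<^sup>2" using \<open>0 \<le> K\<close> by simp
        finally show ?thesis .
      qed (use K elim in auto)
    qed (use elim \<rho> norm_\<beta> H_def in auto)
    then have "(1 - (\<beta> \<epsilon>)\<^sup>2) * (s \<epsilon> - 1 / \<rho>\<^sup>2) \<le> (1 / \<epsilon> + K * \<epsilon>\<^sup>2)\<^sup>2 - (1 - (\<beta> \<epsilon>)\<^sup>2) * (1 / \<epsilon>\<^sup>2)"
      unfolding norm_\<beta> by (simp add: algebra_simps)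
    also have "\<dots> = 2 * K * \<epsilon> + K\<^sup>2 * \<epsilon> ^ 4 + (norm (a 2))\<^sup>2 * \<epsilon>\<^sup>2"
      using elim by (simp add: \<beta>_def field_simps power2_eq_square eval_nat_numeral)
    finally show ?case .
  qed
  moreover have "((\<lambda>\<epsilon>. (1 - (\<beta> \<epsilon>)\<^sup>2) * (s \<epsilon> - 1 / \<rho>\<^sup>2)) \<longlongrightarrow>
      (1 - (norm (a 2) * 0\<^sup>2)\<^sup>2) * ((\<Sum>n<N. real (n + 1) * (norm (a (n + 2)))\<^sup>2 * (\<rho> ^ (2 * n + 2) - 0 ^ (2 * n + 2))) - 1 / \<rho>\<^sup>2))
      (at_right 0)"
    unfolding \<beta>_def s_def by (intro tendsto_intros)
  moreover have "((\<lambda>\<epsilon>. 2 * K * \<epsilon> + K\<^sup>2 * \<epsilon> ^ 4 + (norm (a 2))\<^sup>2 * \<epsilon>\<^sup>2) \<longlongrightarrow>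
      2 * K * 0 + K\<^sup>2 * 0 ^ 4 + (norm (a 2))\<^sup>2 * 0\<^sup>2) (at_right 0)"
    by (intro tendsto_intros)
  ultimately have "(1 - (norm (a 2) * 0\<^sup>2)\<^sup>2) * ((\<Sum>n<N. real (n + 1) * (norm (a (n + 2)))\<^sup>2 * (\<rho> ^ (2 * n + 2) - 0 ^ (2 * n + 2))) - 1 / \<rho>\<^sup>2)
     \<le> 2 * K * 0 + K\<^sup>2 * 0 ^ 4 + (norm (a 2))\<^sup>2 * 0\<^sup>2"
    by (intro tendsto_le[OF trivial_limit_at_right_real])
  then show ?thesis by simp
qed

text \<open>
  Gronwall's area theorem for univalent \<open>p(z) / z\<close>, obtained by letting the radius tend to \<open>1\<close>. The
  weight \<open>n + 1\<close> belongs to the coefficient of \<open>z\<^sup>n\<^sup>+\<^sup>1\<close> in \<open>p(z) / z\<close>.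
\<close>
theorem area_theorem:
  fixes a :: "nat \<Rightarrow> complex"
  assumes sums: "\<And>z. z \<in> ball 0 1 \<Longrightarrow> (\<lambda>n. a n * z ^ n) sums p z" and a0: "a 0 = 1"
    and inj: "inj_on (\<lambda>z. p z / z) (ball 0 1 - {0})"
  shows "(\<Sum>n<N. real (n + 1) * (norm (a (n + 2)))\<^sup>2) \<le> 1"
proof -
  have "eventually (\<lambda>\<rho>::real. 0 < \<rho> \<and> \<rho> < 1) (at_left 1)"
    using eventually_at_left_real[of 0 1] by (auto simp: eventually_at_filter)
  then have "eventually (\<lambda>\<rho>. (\<Sum>n<N. real (n + 1) * (norm (a (n + 2)))\<^sup>2 * \<rho> ^ (2 * n + 2)) \<le> 1 / \<rho>\<^sup>2) (at_left 1)"
    by eventually_elim (rule area_inequality_in_smaller_disc[where p = p, OF sums a0 inj], auto)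
  moreover have "((\<lambda>\<rho>. \<Sum>n<N. real (n + 1) * (norm (a (n + 2)))\<^sup>2 * \<rho> ^ (2 * n + 2)) \<longlongrightarrow>
      (\<Sum>n<N. real (n + 1) * (norm (a (n + 2)))\<^sup>2 * 1 ^ (2 * n + 2))) (at_left 1)"
    by (intro tendsto_intros)
  moreover have "((\<lambda>\<rho>::real. 1 / \<rho>\<^sup>2) \<longlongrightarrow> 1 / 1\<^sup>2) (at_left 1)"
    by (intro tendsto_intros) auto
  ultimately have "(\<Sum>n<N. real (n + 1) * (norm (a (n + 2)))\<^sup>2 * 1 ^ (2 * n + 2)) \<le> 1 / (1::real)\<^sup>2"
    by (intro tendsto_le[OF trivial_limit_at_left_real])
  then show ?thesis by simp
qed

section \<open>The reciprocal of a univalent function\<close>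
lemma class_SD:
  assumes "f \<in> class_S"
  shows "f holomorphic_on ball 0 1" "f 0 = 0" "deriv f 0 = 1" "inj_on f (ball 0 1)"
  using assms by (auto simp: class_S_def class_A_def)

lemma class_S_nonzero:
  assumes "f \<in> class_S" "z \<in> ball 0 1" "z \<noteq> 0"
  shows "f z \<noteq> 0"
  using inj_onD[OF class_SD(4)[OF assms(1)], of z 0] class_SD(2)[OF assms(1)] assms by auto

lemma holomorphic_z_over:
  assumes f: "f \<in> class_S"
  shows "z_over f holomorphic_on ball 0 1"
proof -
  have "(\<lambda>z. if z = 0 then deriv f 0 else (f z - f 0) / (z - 0)) holomorphic_on ball 0 1"
    by (rule pole_lemma_open[OF class_SD(1)[OF f]]) simp
  then have "(\<lambda>z. inverse (if z = 0 then deriv f 0 else (f z - f 0) / (z - 0))) holomorphic_on ball 0 1"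
    by (rule holomorphic_on_inverse) (use class_S_nonzero[OF f] class_SD(2,3)[OF f] in auto)
  moreover have "z_over f = (\<lambda>z. inverse (if z = 0 then deriv f 0 else (f z - f 0) / (z - 0)))"
    using class_SD(2,3)[OF f] by (auto simp: z_over_def fun_eq_iff)
  ultimately show ?thesis by simp
qed

lemma z_over_nonzero:
  assumes "f \<in> class_S" "z \<in> ball 0 1"
  shows "z_over f z \<noteq> 0"
  using class_S_nonzero[OF assms] by (simp add: z_over_def)

lemma z_over_power_series:
  assumes f: "f \<in> class_S" and z: "z \<in> ball 0 1"
  shows "(\<lambda>n. (deriv ^^ n) (z_over f) 0 / fact n * z ^ n) sums z_over f z"
  using holomorphic_power_series[OF holomorphic_z_over[OF f] z] by simp

lemma class_S_area_inequality:
  assumes f: "f \<in> class_S"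
  shows "(\<Sum>n<N. real (n + 1) * (norm ((deriv ^^ (n + 2)) (z_over f) 0 / fact (n + 2)))\<^sup>2) \<le> 1"
proof (rule area_theorem[where p = "z_over f"])
  show "inj_on (\<lambda>z. z_over f z / z) (ball 0 1 - {0})"
  proof (rule inj_onI)
    fix z w assume *: "z \<in> ball 0 1 - {0}" "w \<in> ball 0 1 - {0}" "z_over f z / z = z_over f w / w"
    then have "f z = f w" by (simp add: z_over_def)
    then show "z = w" using inj_onD[OF class_SD(4)[OF f]] * by blast
  qed
  show "(deriv ^^ 0) (z_over f) 0 / fact 0 = 1" by (simp add: z_over_def)
qed (rule z_over_power_series[OF f])

text \<open>
  With \<open>t\<^sup>2 = z / f\<close> and \<open>t(0) = 1\<close>, the odd function \<open>z / t(z\<^sup>2)\<close> is a square root of \<open>f(z\<^sup>2)\<close> and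
  is again univalent. The area theorem bounds the coefficient of \<open>z\<^sup>2\<close> in \<open>t(z\<^sup>2)\<close>, namely
  \<open>t'(0) = b\<^sub>1 / 2\<close>, by \<open>1\<close>.
\<close>
theorem Bieberbach_second_coefficient:
  assumes f: "f \<in> class_S"
  shows "norm (deriv (z_over f) 0) \<le> 2"
proof -
  obtain s where hols: "s holomorphic_on ball 0 1"
    and s: "\<And>z. z \<in> ball 0 1 \<Longrightarrow> z_over f z = (s z)\<^sup>2"
    using contractible_imp_holomorphic_sqrt[OF holomorphic_z_over[OF f]
        convex_imp_contractible[OF convex_ball] z_over_nonzero[OF f]] by metis
  have s0: "(s 0)\<^sup>2 = 1" using s[of 0] by (simp add: z_over_def)
  then have "s 0 \<noteq> 0" by auto
  define t where "t z = s z / s 0" for z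
  have holt: "t holomorphic_on ball 0 1"
    unfolding t_def[abs_def] by (intro holomorphic_intros hols) (use \<open>s 0 \<noteq> 0\<close> in auto)
  have t: "(t z)\<^sup>2 = z_over f z" if "z \<in> ball 0 1" for z
    using s[OF that] s0 by (simp add: t_def power_divide)
  have t0: "t 0 = 1" using \<open>s 0 \<noteq> 0\<close> by (simp add: t_def)
  define c where "c n = (deriv ^^ n) t 0 / fact n" for n
  define a where "a m = (if even m then c (m div 2) else 0)" for m
  have sq: "z\<^sup>2 \<in> ball 0 1" if "z \<in> ball 0 1" for z :: complex
    using that by (simp add: norm_power power_less_one_iff abs_square_less_1)
  have a_sums: "(\<lambda>m. a m * z ^ m) sums t (z\<^sup>2)" if z: "z \<in> ball 0 1" for z
  proof -
    have "(\<lambda>n. c n * (z\<^sup>2) ^ n) sums t (z\<^sup>2)"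
      using holomorphic_power_series[OF holt sq[OF z]] by (simp add: c_def)
    then have *: "(\<lambda>n. a (2 * n) * z ^ (2 * n)) sums t (z\<^sup>2)"
      by (simp add: a_def power_mult)
    have mono: "strict_mono (\<lambda>n::nat. 2 * n)" by (simp add: strict_mono_def)
    have zero: "a m * z ^ m = 0" if "m \<notin> range (\<lambda>n. 2 * n)" for m
    proof -
      have "odd m" using that unfolding dvd_def by blast
      then show ?thesis by (simp add: a_def)
    qed
    show ?thesis
      using sums_mono_reindex[of "\<lambda>n. 2 * n" "\<lambda>m. a m * z ^ m", OF mono zero] * by simp
  qed
  have inj: "inj_on (\<lambda>z. t (z\<^sup>2) / z) (ball 0 1 - {0})"
  proof (rule inj_onI)
    fix z w assume *: "z \<in> ball 0 1 - {0}" "w \<in> ball 0 1 - {0}" "t (z\<^sup>2) / z = t (w\<^sup>2) / w"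
    then have "(t (z\<^sup>2))\<^sup>2 / z\<^sup>2 = (t (w\<^sup>2))\<^sup>2 / w\<^sup>2" by (metis power_divide)
    then have "f (z\<^sup>2) = f (w\<^sup>2)" using * sq by (simp add: t z_over_def)
    then have "z\<^sup>2 = w\<^sup>2"
      using inj_onD[OF class_SD(4)[OF f]] * sq by (metis DiffD1)
    then have "z = w \<or> z = - w" by (simp add: power2_eq_iff)
    moreover have "z \<noteq> - w"
    proof
      assume "z = - w"
      then have "t (w\<^sup>2) = 0" using * by (auto simp: field_simps)
      then have "z_over f (w\<^sup>2) = 0" using t[of "w\<^sup>2"] * sq by auto
      then show False using z_over_nonzero[OF f, of "w\<^sup>2"] * sq by auto
    qed
    ultimately show "z = w" by blast
  qed
  have "a 0 = 1" by (simp add: a_def c_def t0)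
  have "(\<Sum>n<1. real (n + 1) * (norm (a (n + 2)))\<^sup>2) \<le> 1"
    by (rule area_theorem[where p = "\<lambda>z. t (z\<^sup>2)", OF a_sums \<open>a 0 = 1\<close> inj])
  then have "(norm (deriv t 0))\<^sup>2 \<le> 1" by (simp add: a_def c_def)
  then have "norm (deriv t 0) \<le> 1" by (simp add: power_le_one_iff)
  moreover have "deriv (z_over f) 0 = 2 * deriv t 0"
  proof (rule DERIV_imp_deriv)
    have "(t has_field_derivative deriv t 0) (at 0)"
      using holomorphic_derivI[OF holt] by simp
    then have "((\<lambda>z. (t z)\<^sup>2) has_field_derivative 2 * deriv t 0) (at 0)"
      by (auto intro!: derivative_eq_intros simp: t0)
    then show "(z_over f has_field_derivative 2 * deriv t 0) (at 0)"
      by (rule has_field_derivative_transform_within_open[where S = "ball 0 1"]) (auto simp: t)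
  qed
  ultimately show ?thesis by (simp add: norm_mult)
qed

text \<open>
  This transfers everything about \<open>F\<close> to \<open>P = z / F\<close>. It is used for the harmonic mean and also for
  \<open>f\<close> and \<open>g\<close> themselves.
\<close>
lemma quotient_by_reciprocal:
  assumes hol: "P holomorphic_on ball 0 1" and P0: "P 0 = 1"
    and nz: "\<And>z. z \<in> ball 0 1 \<Longrightarrow> P z \<noteq> 0"
    and F: "\<And>z. z \<in> ball 0 1 \<Longrightarrow> F z = z / P z"
  shows quotient_holomorphic: "F holomorphic_on ball 0 1"
    and quotient_deriv: "\<And>z. z \<in> ball 0 1 \<Longrightarrow> deriv F z = (P z - z * deriv P z) / (P z)\<^sup>2"
    and quotient_z_over: "\<And>z. z \<in> ball 0 1 \<Longrightarrow> z_over F z = P z"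
    and quotient_deriv2: "(deriv ^^ 2) F 0 = - 2 * deriv P 0"
proof -
  have "(\<lambda>z. z / P z) holomorphic_on ball 0 1"
    by (intro holomorphic_intros hol) (use nz in auto)
  then show "F holomorphic_on ball 0 1"
    by (rule holomorphic_transform) (simp add: F)
  have P': "(P has_field_derivative deriv P z) (at z)" if "z \<in> ball 0 1" for z
    using holomorphic_derivI[OF hol _ that] by simp
  show F': "deriv F z = (P z - z * deriv P z) / (P z)\<^sup>2" if z: "z \<in> ball 0 1" for z
  proof (rule DERIV_imp_deriv)
    have "((\<lambda>z. z / P z) has_field_derivative (P z - z * deriv P z) / (P z)\<^sup>2) (at z)"
      using nz[OF z] by (auto intro!: derivative_eq_intros P'[OF z] simp: power2_eq_square)
    then show "(F has_field_derivative (P z - z * deriv P z) / (P z)\<^sup>2) (at z)"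
      by (rule has_field_derivative_transform_within_open[where S = "ball 0 1"]) (use z F in auto)
  qed
  show "z_over F z = P z" if "z \<in> ball 0 1" for z
    using nz[OF that] F[OF that] by (simp add: z_over_def P0)
  have P'': "(deriv P has_field_derivative deriv (deriv P) 0) (at 0)"
    using holomorphic_derivI[OF holomorphic_deriv[OF hol]] by simp
  have "((\<lambda>z. (P z - z * deriv P z) / (P z)\<^sup>2) has_field_derivative - 2 * deriv P 0) (at 0)"
    by (auto intro!: derivative_eq_intros P'[of 0] P'' simp: P0)
  then have "(deriv F has_field_derivative - 2 * deriv P 0) (at 0)"
    by (rule has_field_derivative_transform_within_open[where S = "ball 0 1"]) (auto simp: F')
  then show "(deriv ^^ 2) F 0 = - 2 * deriv P 0"
    by (simp add: numeral_2_eq_2 DERIV_imp_deriv)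
qed

section \<open>Functions whose reciprocal satisfies the area inequality\<close>
text \<open>
  Cauchy-Schwarz with the weights \<open>n + 1\<close> split evenly between the factors; the second factor is
  \<open>\<Sum> (n + 1) \<rho>\<^sup>2\<^sup>n = 1 / (1 - \<rho>\<^sup>2)\<^sup>2\<close>.
\<close>
lemma weighted_coefficient_sum:
  fixes b :: "nat \<Rightarrow> complex"
  assumes area: "\<And>N. (\<Sum>n<N. real (n + 1) * (norm (b (n + 2)))\<^sup>2) \<le> 1" and \<rho>: "0 \<le> \<rho>" "\<rho> < 1"
  shows "summable (\<lambda>n. real (n + 1) * norm (b (n + 2)) * \<rho> ^ n)"
    and "(\<Sum>n. real (n + 1) * norm (b (n + 2)) * \<rho> ^ n) \<le> 1 / (1 - \<rho>\<^sup>2)"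
proof -
  have \<rho>2: "\<rho>\<^sup>2 < 1" using \<rho> by (simp add: power_less_one_iff abs_square_less_1)
  have partial: "(\<Sum>n<N. real (n + 1) * norm (b (n + 2)) * \<rho> ^ n) \<le> 1 / (1 - \<rho>\<^sup>2)" for N
  proof -
    have "(\<Sum>n<N. real (n + 1) * norm (b (n + 2)) * \<rho> ^ n)\<^sup>2
        = (\<Sum>n<N. (sqrt (real (n + 1)) * norm (b (n + 2))) * (sqrt (real (n + 1)) * \<rho> ^ n))\<^sup>2"
      by (intro arg_cong[where f = "\<lambda>x. x\<^sup>2"] sum.cong) auto
    also have "\<dots> \<le> (\<Sum>n<N. (sqrt (real (n + 1)) * norm (b (n + 2)))\<^sup>2)
        * (\<Sum>n<N. (sqrt (real (n + 1)) * \<rho> ^ n)\<^sup>2)"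
      by (rule Cauchy_Schwarz_ineq_sum)
    also have "\<dots> = (\<Sum>n<N. real (n + 1) * (norm (b (n + 2)))\<^sup>2) * (\<Sum>n<N. real (Suc n) * (\<rho>\<^sup>2) ^ n)"
      by (simp add: power_mult_distrib mult.commute flip: power_mult)
    also have "\<dots> \<le> 1 * (1 / (1 - \<rho>\<^sup>2)\<^sup>2)"
    proof (rule mult_mono)
      have "(\<lambda>n. real (Suc n) * (\<rho>\<^sup>2) ^ n) sums (1 / (1 - \<rho>\<^sup>2)\<^sup>2)"
        using geometric_deriv_sums[of "\<rho>\<^sup>2"] \<rho>2 by simp
      then show "(\<Sum>n<N. real (Suc n) * (\<rho>\<^sup>2) ^ n) \<le> 1 / (1 - \<rho>\<^sup>2)\<^sup>2"
        using sum_le_suminf[of "\<lambda>n. real (Suc n) * (\<rho>\<^sup>2) ^ n" "{..<N}"]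
        by (simp add: sums_iff)
    qed (use area in \<open>auto intro: sum_nonneg\<close>)
    also have "\<dots> = (1 / (1 - \<rho>\<^sup>2))\<^sup>2" by (simp add: power_divide)
    finally show ?thesis
      by (rule power2_le_imp_le) (use \<rho>2 in simp)
  qed
  show "summable (\<lambda>n. real (n + 1) * norm (b (n + 2)) * \<rho> ^ n)"
    by (rule summableI_nonneg_bounded[OF _ partial]) (use \<rho> in simp)
  then show "(\<Sum>n. real (n + 1) * norm (b (n + 2)) * \<rho> ^ n) \<le> 1 / (1 - \<rho>\<^sup>2)"
    by (rule suminf_le_const) (rule partial)
qed

text \<open>
  The hypothesis says that \<open>u / v\<close> is closer to \<open>1\<close> than to \<open>-1\<close>.
\<close>
lemma Re_divide_pos_if_norm_diff_less:
  assumes "norm (u - v) < norm (u + v)"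
  shows "Re (u / v) > 0"
proof -
  have "(norm (u - v))\<^sup>2 < (norm (u + v))\<^sup>2"
    using assms by (intro power_strict_mono) auto
  then have "Re (u * cnj v) > 0"
    unfolding cmod_power2 by (simp add: power2_eq_square algebra_simps)
  moreover from this have "v \<noteq> 0" by auto
  ultimately show ?thesis
    unfolding complex_div_cnj[of u v] by (simp flip: of_real_power)
qed

lemma norm_sums_le:
  fixes u :: "nat \<Rightarrow> complex"
  assumes "u sums s" "\<And>n. norm (u n) \<le> v n" "summable v"
  shows "norm s \<le> suminf v"
  using norm_suminf_le[OF assms(2,3)] assms(1) by (simp add: sums_iff)

text \<open>
  The area inequality for \<open>P\<close> takes the place of univalence of \<open>F\<close>, which averaging need not preserve.
\<close>
locale area_bounded_reciprocal =
  fixes P F :: "complex \<Rightarrow> complex" and b :: "nat \<Rightarrow> complex"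
  assumes power_series: "\<And>z. z \<in> ball 0 1 \<Longrightarrow> (\<lambda>n. b n * z ^ n) sums P z"
    and b0: "b 0 = 1"
    and area: "\<And>N. (\<Sum>n<N. real (n + 1) * (norm (b (n + 2)))\<^sup>2) \<le> 1"
    and nonzero: "\<And>z. z \<in> ball 0 1 \<Longrightarrow> P z \<noteq> 0"
    and F_eq: "\<And>z. z \<in> ball 0 1 \<Longrightarrow> F z = z / P z"
begin

lemma holP: "P holomorphic_on ball 0 1"
  by (rule power_series_holomorphic[where a = b]) (use power_series in simp)

lemma P0: "P 0 = 1"
  using power_series[of 0] sums_unique2[OF powser_sums_zero[of b]] by (simp add: b0)

lemma holF: "F holomorphic_on ball 0 1"
  and deriv_F: "\<And>z. z \<in> ball 0 1 \<Longrightarrow> deriv F z = (P z - z * deriv P z) / (P z)\<^sup>2"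
  and z_over_F: "\<And>z. z \<in> ball 0 1 \<Longrightarrow> z_over F z = P z"
  and deriv2_F: "(deriv ^^ 2) F 0 = - 2 * deriv P 0"
  using quotient_by_reciprocal[of P F] holP P0 nonzero F_eq by blast+

definition tail :: "real \<Rightarrow> nat \<Rightarrow> real" where
  "tail \<rho> n = real (n + 1) * norm (b (n + 2)) * \<rho> ^ n"

lemma summable_tail: "0 \<le> \<rho> \<Longrightarrow> \<rho> < 1 \<Longrightarrow> summable (tail \<rho>)"
  and suminf_tail_le: "0 \<le> \<rho> \<Longrightarrow> \<rho> < 1 \<Longrightarrow> suminf (tail \<rho>) \<le> 1 / (1 - \<rho>\<^sup>2)"
  unfolding tail_def[abs_def] using weighted_coefficient_sum[OF area] by auto

lemma deviation_bound:
  assumes z: "z \<in> ball 0 1"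
  shows "norm (P z - z * deriv P z - 1) \<le> (norm z)\<^sup>2 / (1 - (norm z)\<^sup>2)"
proof -
  have *: "0 \<le> norm z" "norm z < 1" using z by auto
  have "(\<lambda>n. (1 - of_nat n) * b n * z ^ n) sums (P z - z * deriv P z)"
    using sums_diff[OF power_series[OF z] deriv_power_series[OF power_series z]] by (simp add: algebra_simps)
  then have "(\<lambda>n. (1 - of_nat (n + 2)) * b (n + 2) * z ^ (n + 2)) sums (P z - z * deriv P z - 1)"
    by (subst sums_iff_shift) (simp add: numeral_2_eq_2 b0)
  then have "norm (P z - z * deriv P z - 1) \<le> (\<Sum>n. (norm z)\<^sup>2 * tail (norm z) n)"
  proof (rule norm_sums_le)
    show "norm ((1 - of_nat (n + 2)) * b (n + 2) * z ^ (n + 2)) \<le> (norm z)\<^sup>2 * tail (norm z) n" for n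
    proof -
      have "1 - of_nat (n + 2) = - (of_nat (n + 1) :: complex)" by simp
      then have "norm (1 - of_nat (n + 2) :: complex) = real (n + 1)"
        by (metis norm_minus_cancel norm_of_nat)
      then show ?thesis
        unfolding norm_mult tail_def norm_power power_add by simp
    qed
    show "summable (\<lambda>n. (norm z)\<^sup>2 * tail (norm z) n)"
      by (intro summable_mult summable_tail *)
  qed
  also have "\<dots> = (norm z)\<^sup>2 * suminf (tail (norm z))"
    by (rule suminf_mult[OF summable_tail[OF *]])
  also have "\<dots> \<le> (norm z)\<^sup>2 * (1 / (1 - (norm z)\<^sup>2))"
    by (intro mult_left_mono suminf_tail_le *) simp
  finally show ?thesis by simp
qed

lemma F_U_deviation_bound:
  assumes z: "z \<in> ball 0 1"
  shows "norm (deriv F z * (z_over F z)\<^sup>2 - 1) \<le> (norm z)\<^sup>2 / (1 - (norm z)\<^sup>2)"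
  using deviation_bound[OF z] deriv_F[OF z] z_over_F[OF z] nonzero[OF z] by simp

text \<open>
  Put \<open>\<psi>(z) = (P(z) - 1) / z\<close>. If \<open>F(z) = F(w)\<close>, then \<open>1 / z + \<psi>(z) = 1 / w + \<psi>(w)\<close>, so
  \<open>|w - z| = |z w| |\<psi>(w) - \<psi>(z)|\<close>. On the disc of radius \<open>\<rho> = max |z| |w|\<close> the derivative of \<open>\<psi>\<close> is at
  most \<open>1 / (1 - \<rho>\<^sup>2)\<close>, and \<open>\<rho>\<^sup>2 / (1 - \<rho>\<^sup>2) < 1\<close> for \<open>\<rho>\<^sup>2 < 1/2\<close>.
\<close>
lemma inj_on_F: "inj_on F (ball 0 (1 / sqrt 2))"
proof (rule inj_onI, rule ccontr)
  fix z w :: complex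
  assume z: "z \<in> ball 0 (1 / sqrt 2)" and w: "w \<in> ball 0 (1 / sqrt 2)"
    and eq: "F z = F w" and "z \<noteq> w"
  define \<psi> where "\<psi> z = (\<Sum>n. b (n + 1) * z ^ n)" for z
  have \<psi>: "(\<lambda>n. b (n + 1) * v ^ n) sums \<psi> v" if "v \<in> ball 0 1" for v
    unfolding \<psi>_def
    using sums_summable[OF power_series[OF that]] summable_powser_ignore_initial_segment[of b 1 v]
    by (intro summable_sums) simp
  have P_eq: "P v = 1 + v * \<psi> v" if v: "v \<in> ball 0 1" for v
  proof -
    have "(\<lambda>n. b (Suc n) * v ^ Suc n) sums (v * \<psi> v)"
      using sums_mult[OF \<psi>[OF v], of v] by (simp add: mult_ac)
    then have "(\<lambda>n. b n * v ^ n) sums (v * \<psi> v + 1)"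
      by (subst (asm) sums_Suc_iff) (simp add: b0)
    with power_series[OF v] show ?thesis
      using sums_unique2 by (metis add.commute)
  qed
  define \<rho> where "\<rho> = max (norm z) (norm w)"
  have \<rho>: "0 \<le> \<rho>" "\<rho> < 1 / sqrt 2" using z w by (auto simp: \<rho>_def le_max_iff_disj)
  have "\<rho>\<^sup>2 < (1 / sqrt 2)\<^sup>2" using \<rho> by (intro power_strict_mono) auto
  then have \<rho>2: "\<rho>\<^sup>2 < 1 / 2" by (simp add: power_divide)
  have "1 / sqrt 2 < (1 :: real)" by simp
  then have "\<rho> < 1" using \<rho> by linarith
  have "norm (\<psi> w - \<psi> z) \<le> 1 / (1 - \<rho>\<^sup>2) * norm (w - z)"
  proof (rule field_differentiable_bound[where S = "cball 0 \<rho>" and f' = "deriv \<psi>"])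
    fix v :: complex assume v: "v \<in> cball 0 \<rho>"
    then have v1: "v \<in> ball 0 1" using \<open>\<rho> < 1\<close> by auto
    have "\<psi> holomorphic_on ball 0 1"
      by (rule power_series_holomorphic[where a = "\<lambda>n. b (n + 1)"]) (use \<psi> in simp)
    then have D: "(\<psi> has_field_derivative deriv \<psi> v) (at v)"
      using holomorphic_derivI v1 by blast
    then show "(\<psi> has_field_derivative deriv \<psi> v) (at v within cball 0 \<rho>)"
      by (rule has_field_derivative_at_within)
    have "(\<lambda>n. diffs (\<lambda>n. b (n + 1)) n * v ^ n) sums deriv \<psi> v"
      by (rule termdiffs_sums_strong[where K = 1 and f = \<psi>]) (use \<psi> D v1 in auto)
    then have "norm (deriv \<psi> v) \<le> suminf (tail \<rho>)"
    proof (rule norm_sums_le)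
      show "norm (diffs (\<lambda>n. b (n + 1)) n * v ^ n) \<le> tail \<rho> n" for n
      proof -
        have "diffs (\<lambda>n. b (n + 1)) n = of_nat (n + 1) * b (n + 2)"
          by (simp add: diffs_def)
        then show ?thesis
          using v unfolding tail_def norm_mult norm_power norm_of_nat
          by (simp add: norm_mult norm_of_nat del: of_nat_Suc of_nat_add)
             (intro mult_left_mono power_mono; simp)
      qed
      show "summable (tail \<rho>)" by (rule summable_tail[OF \<rho>(1) \<open>\<rho> < 1\<close>])
    qed
    also have "\<dots> \<le> 1 / (1 - \<rho>\<^sup>2)" by (rule suminf_tail_le[OF \<rho>(1) \<open>\<rho> < 1\<close>])
    finally show "norm (deriv \<psi> v) \<le> 1 / (1 - \<rho>\<^sup>2)" .
  qed (auto simp: \<rho>_def)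
  moreover have "norm (w - z) = norm (z * w) * norm (\<psi> w - \<psi> z)"
  proof -
    have zw1: "z \<in> ball 0 1" "w \<in> ball 0 1" using \<open>\<rho> < 1\<close> by (auto simp: \<rho>_def)
    have "z * P w = w * P z"
      using eq F_eq[OF zw1(1)] F_eq[OF zw1(2)] nonzero zw1 by (simp add: field_simps)
    then have "w - z = z * w * (\<psi> w - \<psi> z)"
      unfolding P_eq[OF zw1(1)] P_eq[OF zw1(2)] by (simp add: algebra_simps)
    then show ?thesis by (metis norm_mult)
  qed
  ultimately have "norm (w - z) \<le> norm (z * w) * (1 / (1 - \<rho>\<^sup>2) * norm (w - z))"
    by (metis mult_left_mono norm_ge_zero)
  also have "\<dots> \<le> \<rho>\<^sup>2 * (1 / (1 - \<rho>\<^sup>2) * norm (w - z))"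
  proof (rule mult_right_mono)
    show "norm (z * w) \<le> \<rho>\<^sup>2"
      unfolding norm_mult power2_eq_square by (intro mult_mono) (auto simp: \<rho>_def le_max_iff_disj)
  qed (use \<rho>2 in simp)
  also have "\<dots> = \<rho>\<^sup>2 / (1 - \<rho>\<^sup>2) * norm (w - z)" by simp
  also have "\<dots> < 1 * norm (w - z)"
    using \<rho>2 \<open>z \<noteq> w\<close> by (intro mult_strict_right_mono) (simp_all add: field_simps)
  finally show False by simp
qed

text \<open>
  By \<open>Re_divide_pos_if_norm_diff_less\<close> it suffices that \<open>|z P'| < |2 P - z P'|\<close>. The series of
  the two sides are \<open>b\<^sub>1 z + \<Sum> n b\<^sub>n z\<^sup>n\<close> and \<open>2 + b\<^sub>1 z - \<Sum> (n - 2) b\<^sub>n z\<^sup>n\<close>, summed over \<open>n \<ge> 2\<close>; adding the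
  weights \<open>n\<close> and \<open>n - 2\<close> gives twice the weight \<open>n - 1\<close> of the tail.
\<close>
lemma Re_starlike_quotient_pos:
  assumes z: "z \<in> ball 0 1" "z \<noteq> 0"
    and small: "norm (b 1) * norm z + (norm z)\<^sup>2 / (1 - (norm z)\<^sup>2) < 1"
  shows "Re (z * deriv F z / F z) > 0"
proof -
  define \<rho> where "\<rho> = norm z"
  have \<rho>: "0 \<le> \<rho>" "\<rho> < 1" using z by (auto simp: \<rho>_def)
  define U where "U n = real (n + 2) * norm (b (n + 2)) * \<rho> ^ (n + 2)" for n
  define V where "V n = real n * norm (b (n + 2)) * \<rho> ^ (n + 2)" for n
  have UV: "U n + V n = 2 * \<rho>\<^sup>2 * tail \<rho> n" for n
    by (simp add: U_def V_def tail_def power2_eq_square algebra_simps)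
  have nonneg: "0 \<le> U n" "0 \<le> V n" for n using \<rho> by (auto simp: U_def V_def)
  have sUV: "summable (\<lambda>n. 2 * \<rho>\<^sup>2 * tail \<rho> n)"
    by (intro summable_mult summable_tail \<rho>)
  have U: "summable U"
    by (rule summable_comparison_test'[OF sUV, of 0]) (use nonneg UV in \<open>simp add: UV[symmetric]\<close>)
  have V: "summable V"
    by (rule summable_comparison_test'[OF sUV, of 0]) (use nonneg UV in \<open>simp add: UV[symmetric]\<close>)
  have "suminf U + suminf V = (\<Sum>n. 2 * \<rho>\<^sup>2 * tail \<rho> n)"
    using suminf_add[OF U V] by (simp add: UV)
  also have "\<dots> = 2 * \<rho>\<^sup>2 * suminf (tail \<rho>)"
    by (rule suminf_mult[OF summable_tail[OF \<rho>]])
  also have "\<dots> \<le> 2 * \<rho>\<^sup>2 * (1 / (1 - \<rho>\<^sup>2))"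
    by (intro mult_left_mono suminf_tail_le \<rho>) simp
  finally have sum_le: "suminf U + suminf V \<le> 2 * (\<rho>\<^sup>2 / (1 - \<rho>\<^sup>2))" by simp
  have "(\<lambda>n. of_nat (n + 2) * b (n + 2) * z ^ (n + 2)) sums (z * deriv P z - b 1 * z)"
    using deriv_power_series[OF power_series z(1)] by (subst sums_iff_shift) (simp add: numeral_2_eq_2)
  then have "norm (z * deriv P z - b 1 * z) \<le> suminf U"
    by (rule norm_sums_le[OF _ _ U]) (simp add: U_def norm_mult norm_power \<rho>_def del: of_nat_add of_nat_Suc)
  then have A: "norm (z * deriv P z) \<le> norm (b 1) * \<rho> + suminf U"
    using norm_triangle_ineq2[of "z * deriv P z" "b 1 * z"] by (simp add: norm_mult \<rho>_def)
  have "(\<lambda>n. (2 - of_nat n) * b n * z ^ n) sums (2 * P z - z * deriv P z)"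
    using sums_diff[OF sums_mult[OF power_series[OF z(1)], of 2] deriv_power_series[OF power_series z(1)]]
    by (simp add: algebra_simps)
  then have "(\<lambda>n. (2 - of_nat (n + 2)) * b (n + 2) * z ^ (n + 2)) sums (2 * P z - z * deriv P z - (2 + b 1 * z))"
    by (subst sums_iff_shift) (simp add: numeral_2_eq_2 b0 algebra_simps)
  then have "norm (2 * P z - z * deriv P z - (2 + b 1 * z)) \<le> suminf V"
    by (rule norm_sums_le[OF _ _ V]) (simp add: V_def norm_mult norm_power \<rho>_def)
  moreover have "2 \<le> norm (2 * P z - z * deriv P z) + norm (2 * P z - z * deriv P z - (2 + b 1 * z)) + norm (b 1) * \<rho>"
    using norm_triangle_ineq4[of "2 + b 1 * z" "b 1 * z"]
      norm_triangle_ineq4[of "2 * P z - z * deriv P z" "2 * P z - z * deriv P z - (2 + b 1 * z)"]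
    by (simp add: norm_mult \<rho>_def)
  ultimately have "norm (z * deriv P z) < norm (2 * P z - z * deriv P z)"
    using A sum_le small unfolding \<rho>_def[symmetric] by linarith
  then have "Re ((P z - z * deriv P z) / P z) > 0"
    by (intro Re_divide_pos_if_norm_diff_less) (simp add: algebra_simps)
  moreover have "z * deriv F z / F z = (P z - z * deriv P z) / P z"
    using z nonzero[OF z(1)] F_eq[OF z(1)] deriv_F[OF z(1)] by (simp add: power2_eq_square)
  ultimately show ?thesis by simp
qed

end

section \<open>The harmonic mean of two univalent functions\<close>
lemma rescale_in_class_U:
  assumes hol: "F holomorphic_on ball 0 1" and F0: "F 0 = 0" "deriv F 0 = 1"
    and bound: "\<And>z. z \<in> ball 0 1 \<Longrightarrow>
      norm (deriv F z * (z_over F z)\<^sup>2 - 1) \<le> (norm z)\<^sup>2 / (1 - (norm z)\<^sup>2)"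
    and lam: "0 < lam" and r: "0 < r" "r \<le> sqrt (lam / (1 + lam))"
  shows "rescale r F \<in> class_U lam"
proof -
  have "r\<^sup>2 \<le> (sqrt (lam / (1 + lam)))\<^sup>2" using r by (intro power_mono) auto
  then have r2: "r\<^sup>2 \<le> lam / (1 + lam)" using lam by simp
  also have "\<dots> < 1" using lam by simp
  finally have "r < 1" using r by (simp add: power_less_one_iff)
  have holr: "F holomorphic_on ball 0 r"
    by (rule holomorphic_on_subset[OF hol]) (use \<open>r < 1\<close> in auto)
  have "norm (deriv (rescale r F) z * (z_over (rescale r F) z)\<^sup>2 - 1) < lam"
    if z: "z \<in> ball 0 1" for z
  proof -
    define w where "w = of_real r * z"
    have w: "norm w < r" using z r by (simp add: w_def norm_mult)
    then have "(norm w)\<^sup>2 < r\<^sup>2" by (intro power_strict_mono) auto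
    then have w2: "(norm w)\<^sup>2 < lam / (1 + lam)" using r2 by linarith
    have "(norm w)\<^sup>2 < 1" using w2 \<open>lam / (1 + lam) < 1\<close> by linarith
    have "deriv (rescale r F) z = deriv F w" "z_over (rescale r F) z = z_over F w"
      using deriv_rescale[OF r(1) holr z] z_over_rescale[OF r(1)] by (simp_all add: w_def)
    then have "norm (deriv (rescale r F) z * (z_over (rescale r F) z)\<^sup>2 - 1) \<le> (norm w)\<^sup>2 / (1 - (norm w)\<^sup>2)"
      using bound[of w] w \<open>r < 1\<close> by simp
    also have "\<dots> < lam"
      using w2 \<open>(norm w)\<^sup>2 < 1\<close> lam by (simp add: field_simps)
    finally show ?thesis .
  qed
  moreover have "rescale r F holomorphic_on ball 0 1"
    using holomorphic_on_rescale_iff[OF r(1)] holr by simp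
  moreover have "rescale r F 0 = 0" using F0 by (simp add: rescale_def)
  moreover have "deriv (rescale r F) 0 = 1"
    using deriv_rescale[OF r(1) holr, of 0] F0 by simp
  ultimately show ?thesis by (simp add: class_U_def class_A_def)
qed

lemma rescale_in_class_S_star:
  assumes hol: "F holomorphic_on ball 0 r" and F0: "F 0 = 0" "deriv F 0 = 1"
    and inj: "inj_on F (ball 0 r)" and r: "0 < r"
    and star: "\<And>z. z \<in> ball 0 r \<Longrightarrow> z \<noteq> 0 \<Longrightarrow> Re (z * deriv F z / F z) > 0"
  shows "rescale r F \<in> class_S_star"
proof -
  have "rescale r F holomorphic_on ball 0 1"
    using holomorphic_on_rescale_iff[OF r] hol by simp
  moreover have "rescale r F 0 = 0" using F0 by (simp add: rescale_def)
  moreover have "deriv (rescale r F) 0 = 1"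
    using deriv_rescale[OF r hol, of 0] F0 by simp
  moreover have scaled: "of_real r * z \<in> ball 0 r" if "z \<in> ball 0 1" for z :: complex
    using that r by (simp add: norm_mult)
  moreover have "inj_on (rescale r F) (ball 0 1)"
  proof (rule inj_onI)
    fix z w assume "z \<in> ball 0 1" "w \<in> ball 0 1" "rescale r F z = rescale r F w"
    then have "of_real r * z = of_real r * w"
      using inj_onD[OF inj _ scaled scaled] r by (simp add: rescale_def)
    then show "z = w" using r by simp
  qed
  moreover have "Re (z * deriv (rescale r F) z / rescale r F z) > 0" if z: "z \<in> ball 0 1" "z \<noteq> 0" for z
  proof -
    have "z * deriv (rescale r F) z / rescale r F z
        = (of_real r * z) * deriv F (of_real r * z) / F (of_real r * z)"
      unfolding deriv_rescale[OF r hol z(1)] by (simp add: rescale_def)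
    then show ?thesis using star[OF scaled[OF z(1)]] z r by simp
  qed
  ultimately show ?thesis by (simp add: class_S_star_def class_S_def class_A_def)
qed

lemma recip_coeff1_eq: "recip_coeff1 f = deriv (z_over f) 0"
  by (simp add: recip_coeff1_def fps_expansion_def)

lemma class_S_deriv2:
  assumes f: "f \<in> class_S"
  shows "(deriv ^^ 2) f 0 = - 2 * recip_coeff1 f"
  unfolding recip_coeff1_eq
proof (rule quotient_deriv2[OF holomorphic_z_over[OF f]])
  show "f z = z / z_over f z" if "z \<in> ball 0 1" for z
    using class_S_nonzero[OF f that] class_SD(2)[OF f] by (simp add: z_over_def)
qed (use z_over_nonzero[OF f] in \<open>auto simp: z_over_def\<close>)

text \<open>
  The case \<open>z = 0\<close> holds by the values chosen at the removable singularities.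
\<close>
lemma harmonic_mean_eq:
  assumes f: "f \<in> class_S" and g: "g \<in> class_S" and z: "z \<in> ball 0 1"
    and nz: "z \<noteq> 0 \<Longrightarrow> f z + g z \<noteq> 0"
  shows "(z_over f z + z_over g z) / 2 \<noteq> 0"
    and "harmonic_mean f g z = z / ((z_over f z + z_over g z) / 2)"
proof -
  have "(z_over f z + z_over g z) / 2 \<noteq> 0 \<and> harmonic_mean f g z = z / ((z_over f z + z_over g z) / 2)"
  proof (cases "z = 0")
    case False
    have "(z_over f z + z_over g z) / 2 = z * (f z + g z) / (2 * f z * g z)"
      using False class_S_nonzero[OF f z] class_S_nonzero[OF g z]
      by (simp add: z_over_def field_simps)
    then show ?thesis
      using False nz class_S_nonzero[OF f z] class_S_nonzero[OF g z]
      by (simp add: harmonic_mean_def)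
  qed (simp add: z_over_def harmonic_mean_def)
  then show "(z_over f z + z_over g z) / 2 \<noteq> 0"
    "harmonic_mean f g z = z / ((z_over f z + z_over g z) / 2)" by auto
qed

text \<open>
  The area inequality is stable under averaging because \<open>|w|\<^sup>2\<close> is convex.
\<close>
lemma area_inequality_mean:
  fixes a c :: "nat \<Rightarrow> complex"
  assumes "(\<Sum>n<N. real (n + 1) * (norm (a n))\<^sup>2) \<le> 1" "(\<Sum>n<N. real (n + 1) * (norm (c n))\<^sup>2) \<le> 1"
  shows "(\<Sum>n<N. real (n + 1) * (norm ((a n + c n) / 2))\<^sup>2) \<le> 1"
proof -
  have "(norm ((a n + c n) / 2))\<^sup>2 \<le> ((norm (a n))\<^sup>2 + (norm (c n))\<^sup>2) / 2" for n
  proof -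
    have "(norm (a n + c n))\<^sup>2 \<le> (norm (a n) + norm (c n))\<^sup>2"
      by (intro power_mono norm_triangle_ineq) auto
    also have "\<dots> \<le> 2 * ((norm (a n))\<^sup>2 + (norm (c n))\<^sup>2)"
      using zero_le_power2[of "norm (a n) - norm (c n)"] by (simp add: power2_eq_square algebra_simps)
    finally show ?thesis by (simp add: norm_divide power_divide)
  qed
  then have "(\<Sum>n<N. real (n + 1) * (norm ((a n + c n) / 2))\<^sup>2)
      \<le> (\<Sum>n<N. real (n + 1) * (((norm (a n))\<^sup>2 + (norm (c n))\<^sup>2) / 2))"
    by (intro sum_mono mult_left_mono) auto
  also have "\<dots> = ((\<Sum>n<N. real (n + 1) * (norm (a n))\<^sup>2) + (\<Sum>n<N. real (n + 1) * (norm (c n))\<^sup>2)) / 2"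
    by (simp add: sum_divide_distrib sum.distrib[symmetric] add_divide_distrib algebra_simps)
  also have "\<dots> \<le> 1" using add_mono[OF assms] by simp
  finally show ?thesis .
qed

text \<open>
  A positive radius can exist only if \<open>a < 1\<close>, and then the bound reads
  \<open>r\<^sup>2 \<le> (1 - a) / (2 - a)\<close>, which is the solution of \<open>r\<^sup>2 / (1 - r\<^sup>2) \<le> 1 - a\<close>.
\<close>
lemma starlike_radius_bound:
  fixes a r :: real
  assumes a: "0 \<le> a" "a < 2" and r: "0 < r" "r \<le> sqrt (1 - 2 / (4 - 2 * a))"
  shows "r \<le> 1 / sqrt 2"
    and "\<And>\<rho>. 0 \<le> \<rho> \<Longrightarrow> \<rho> < r \<Longrightarrow> a * \<rho> + \<rho>\<^sup>2 / (1 - \<rho>\<^sup>2) < 1"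
proof -
  have "0 < sqrt (1 - 2 / (4 - 2 * a))" using r by linarith
  then have pos: "0 < 1 - 2 / (4 - 2 * a)" by simp
  have eq: "1 - 2 / (4 - 2 * a) = (1 - a) / (2 - a)" using a by (simp add: field_simps)
  have a1: "a < 1" using pos a unfolding eq by (simp add: zero_less_divide_iff)
  have "r\<^sup>2 \<le> (sqrt (1 - 2 / (4 - 2 * a)))\<^sup>2" using r by (intro power_mono) auto
  then have r2: "r\<^sup>2 \<le> (1 - a) / (2 - a)" using pos eq by simp
  also have half: "\<dots> \<le> 1 / 2" using a a1 by (simp add: field_simps)
  finally have "sqrt (r\<^sup>2) \<le> sqrt (1 / 2)" by (rule real_sqrt_le_mono)
  then show "r \<le> 1 / sqrt 2" using r by (simp add: real_sqrt_divide)
  fix \<rho> :: real assume \<rho>: "0 \<le> \<rho>" "\<rho> < r"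
  then have "\<rho>\<^sup>2 < r\<^sup>2" by (intro power_strict_mono) auto
  then have \<rho>2: "\<rho>\<^sup>2 < (1 - a) / (2 - a)" using r2 by linarith
  have "\<rho>\<^sup>2 < 1" using \<rho>2 half by linarith
  have "\<rho>\<^sup>2 * (2 - a) < 1 - a" using \<rho>2 a by (simp add: field_simps)
  then have "\<rho>\<^sup>2 < (1 - a) * (1 - \<rho>\<^sup>2)" by (simp add: algebra_simps)
  then have "\<rho>\<^sup>2 / (1 - \<rho>\<^sup>2) < 1 - a" using \<open>\<rho>\<^sup>2 < 1\<close> by (simp add: pos_divide_less_eq)
  moreover have "\<rho> \<le> 1" using \<open>\<rho>\<^sup>2 < 1\<close> \<rho> by (simp add: abs_square_less_1)
  then have "a * \<rho> \<le> a" using a mult_left_mono[of \<rho> 1 a] by simp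
  ultimately show "a * \<rho> + \<rho>\<^sup>2 / (1 - \<rho>\<^sup>2) < 1" by linarith
qed

theorem theorem1:
  fixes f g :: "complex \<Rightarrow> complex"
  assumes "f \<in> class_S" and "g \<in> class_S"
    and "\<forall>z\<in>ball 0 1. (if z = 0 then 2 else (f z + g z) / z) \<noteq> 0"
  shows
    "(\<forall>lam::real. 0 < lam \<and> lam \<le> 1 \<longrightarrow>
        (\<forall>r::real. 0 < r \<and> r \<le> sqrt (lam / (1 + lam)) \<longrightarrow>
           rescale r (harmonic_mean f g) \<in> class_U lam))
     \<and> U_in_disk (harmonic_mean f g) (1 / sqrt 2)
     \<and> inj_on (harmonic_mean f g) (ball 0 (1 / sqrt 2))
     \<and> recip_coeff1 f + recip_coeff1 g = - ((deriv ^^ 2) f 0 + (deriv ^^ 2) g 0) / 2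
     \<and> recip_coeff1 f + recip_coeff1 g = - (deriv ^^ 2) (harmonic_mean f g) 0
     \<and> (norm (recip_coeff1 f + recip_coeff1 g) \<noteq> 4 \<longrightarrow>
        (\<forall>r::real. 0 < r \<and> r \<le> sqrt (1 - 2 / (4 - norm (recip_coeff1 f + recip_coeff1 g))) \<longrightarrow>
           rescale r (harmonic_mean f g) \<in> class_S_star))"
proof -
  note f = assms(1) and g = assms(2)
  define F where "F = harmonic_mean f g"
  define P where "P z = (z_over f z + z_over g z) / 2" for z
  define b where "b n = ((deriv ^^ n) (z_over f) 0 / fact n + (deriv ^^ n) (z_over g) 0 / fact n) / 2" for n
  have nz: "f z + g z \<noteq> 0" if "z \<in> ball 0 1" "z \<noteq> 0" for z
    using assms(3)[rule_format, OF that(1)] that(2) by auto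
  interpret area_bounded_reciprocal P F b
  proof
    show "(\<lambda>n. b n * z ^ n) sums P z" if z: "z \<in> ball 0 1" for z
      using sums_divide[OF sums_add[OF z_over_power_series[OF f z] z_over_power_series[OF g z]], of 2]
      by (simp add: b_def P_def ring_distribs add_divide_distrib)
    show "b 0 = 1" by (simp add: b_def z_over_def)
    show "(\<Sum>n<N. real (n + 1) * (norm (b (n + 2)))\<^sup>2) \<le> 1" for N
      unfolding b_def by (rule area_inequality_mean[OF class_S_area_inequality[OF f] class_S_area_inequality[OF g]])
    show "P z \<noteq> 0" "F z = z / P z" if "z \<in> ball 0 1" for z
      unfolding P_def F_def using harmonic_mean_eq[OF f g that nz[OF that]] by auto
  qed
  have F0: "F 0 = 0" "deriv F 0 = 1"
    using F_eq[of 0] deriv_F[of 0] by (simp_all add: P0)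
  have b1: "recip_coeff1 f + recip_coeff1 g = 2 * b 1"
    by (simp add: recip_coeff1_eq b_def)
  have dP: "2 * deriv P 0 = recip_coeff1 f + recip_coeff1 g"
  proof -
    have "(z_over f has_field_derivative deriv (z_over f) 0) (at 0)"
      "(z_over g has_field_derivative deriv (z_over g) 0) (at 0)"
      using holomorphic_derivI[OF holomorphic_z_over[OF f]] holomorphic_derivI[OF holomorphic_z_over[OF g]]
      by simp_all
    then have "(P has_field_derivative (deriv (z_over f) 0 + deriv (z_over g) 0) / 2) (at 0)"
      unfolding P_def[abs_def] by (intro DERIV_cdivide DERIV_add)
    then show ?thesis by (simp add: DERIV_imp_deriv recip_coeff1_eq)
  qed
  have U: "rescale r F \<in> class_U lam" if "0 < lam" "0 < r" "r \<le> sqrt (lam / (1 + lam))" for lam r :: real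
    by (rule rescale_in_class_U[OF holF F0 F_U_deviation_bound that])
  have U1: "U_in_disk F (1 / sqrt 2)"
  proof -
    have "rescale (1 / sqrt 2) F \<in> class_U 1"
      by (rule U) (auto simp: real_sqrt_divide)
    then show ?thesis by (subst U_in_disk_iff) auto
  qed
  have S: "rescale r F \<in> class_S_star"
    if ne: "norm (recip_coeff1 f + recip_coeff1 g) \<noteq> 4"
      and r: "0 < r" "r \<le> sqrt (1 - 2 / (4 - norm (recip_coeff1 f + recip_coeff1 g)))" for r :: real
  proof -
    have norm_b1: "norm (recip_coeff1 f + recip_coeff1 g) = 2 * norm (b 1)"
      by (simp add: b1 norm_mult)
    \<comment> \<open>Without this bound the radius could come from the branch \<open>|b\<^sub>1 + c\<^sub>1| > 4\<close>, where it exceeds \<open>1\<close>.\<close>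
    have "norm (recip_coeff1 f + recip_coeff1 g) \<le> 2 + 2"
      unfolding recip_coeff1_eq
      by (intro norm_triangle_mono Bieberbach_second_coefficient f g)
    then have b1_less: "norm (b 1) < 2" using ne norm_b1 by simp
    note radius = starlike_radius_bound[OF norm_ge_zero b1_less r[unfolded norm_b1]]
    have "1 / sqrt 2 < (1 :: real)" by simp
    then have "r < 1" using radius(1) by linarith
    show ?thesis
    proof (rule rescale_in_class_S_star[OF _ F0 _ r(1)])
      show "F holomorphic_on ball 0 r"
        by (rule holomorphic_on_subset[OF holF]) (use \<open>r < 1\<close> in auto)
      show "inj_on F (ball 0 r)"
        by (rule inj_on_subset[OF inj_on_F]) (use radius(1) in auto)
      show "Re (z * deriv F z / F z) > 0" if "z \<in> ball 0 r" "z \<noteq> 0" for z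
        by (rule Re_starlike_quotient_pos) (use that \<open>r < 1\<close> radius(2)[of "norm z"] in auto)
    qed
  qed
  have "recip_coeff1 f + recip_coeff1 g = - ((deriv ^^ 2) f 0 + (deriv ^^ 2) g 0) / 2"
    unfolding class_S_deriv2[OF f] class_S_deriv2[OF g] by simp
  moreover have "recip_coeff1 f + recip_coeff1 g = - (deriv ^^ 2) F 0"
    unfolding deriv2_F dP[symmetric] by simp
  ultimately show ?thesis
    using U U1 inj_on_F S unfolding F_def by blast
qed

end
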